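(* Suppose we are given three prequantum systems arising from symplectic manifolds $M,N,P$, with prequantum line bundles $\mathcal{L}_M,\mathcal{L}_N,\mathcal{L}_P$. Let $\sigma\in\Gamma^*(M\times\overline{N},\mathcal{L}_M\otimes\mathcal{L}_N^* )$ and $\zeta\in\Gamma^*(N\times\overline{P},\mathcal{L}_N\otimes\mathcal{L}_P^* )$. Then $$L(\sigma\circ\zeta)=L\sigma\circ\zeta+\sigma\circ L\zeta.$$
   Context: A prequantum system is a quadruple $(M,\omega_M,\mathcal{L}_M,\nabla_M)$ where $(M,\omega_M)$ is a compact connected symplectic manifold and $\mathcal{L}_M\to M$ is a hermitian complex line bundle with unitary connection $\nabla_M$ of curvature $\omega_M$, normalized so that the induced operator on $\Omega^*(M,\mathcal{L}_M)$ satisfies $\nabla_M^2=-i\,\omega_M\wedge$. The dual system is $\overline{M}=(M,-\omega_M,\mathcal{L}_M^*,\nabla_M^+)$, with $\nabla_M^+$ the induced dual connection. The product $M\times\overline{N}$ is the prequantum system with form $\omega_M-\omega_N$, line bundle $\mathcal{L}_M\otimes\mathcal{L}_N^*$ (pullbacks suppressed) and the tensor product connection. For a prequantum system $(X,\omega,\mathcal{L},\nabla)$, $L=\omega\wedge$ on $\Omega^*(X,\mathcal{L})$ and $\Gamma^*(X,\mathcal{L})=\ker L$. Thus $L$ is wedge product with $\omega_M-\omega_N$, $\omega_N-\omega_P$, $\omega_M-\omega_P$ on forms on $M\times\overline{N}$, $N\times\overline{P}$, $M\times\overline{P}$ respectively. Composition: let $i,j,k$ be the projections of $M\times N\times P$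 to $M\times N$, $N\times P$, $M\times P$ respectively. For $\xi\in\Omega^*(M\times\overline{N},\mathcal{L}_M\otimes\mathcal{L}_N^* )$ and $\eta\in\Omega^*(N\times\overline{P},\mathcal{L}_N\otimes\mathcal{L}_P^* )$, $$\xi\circ\eta=k_*\,\hat c_N(i^*\xi\wedge j^*\eta)\in\Omega^*(M\times\overline{P},\mathcal{L}_M\otimes\mathcal{L}_P^* ),$$ where $\hat c_N:\mathcal{L}_M\otimes\mathcal{L}_N^*\otimes\mathcal{L}_N\otimes\mathcal{L}_P^*\to\mathcal{L}_M\otimes\mathcal{L}_P^*$ is the natural ($\mathbb{C}$-linear) contraction and $k_*$ is fibre integration over $N$ with its symplectic orientation. *)

theory Defs
  imports "HOL-Analysis.Analysis" "HOL-Library.Function_Algebras"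
begin

section \<open>Linear algebra\<close>

subsection \<open>Model spaces of charts\<close>

text \<open>
  Charts take values in a finite-dimensional real vector space. The class \<open>euclidean_space\<close> is not
  used for this purpose because it excludes dimension 0, while a point is a legitimate compact
  connected symplectic manifold. Second countability follows from the other axioms.
\<close>

class finite_dim_normed = real_normed_vector + second_countable_topology +
  assumes finite_spanning_list: "\<exists>bs. \<forall>x. \<exists>c. x = foldr (\<lambda>b y. c b *\<^sub>R b + y) bs 0"

lemma foldr_scaleR_eq_sum:
  fixes bs :: "'a::real_vector list"
  assumes "distinct bs"
  shows "foldr (\<lambda>b y. c b *\<^sub>R b + y) bs 0 = (\<Sum>b\<in>set bs. c b *\<^sub>R b)"
  using assms by (induction bs) auto

lemma finite_dim: "\<exists>B::'a::finite_dim_normed set. finite B \<and> span B = UNIV"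
proof -
  obtain bs :: "'a list" where bs: "\<forall>x. \<exists>c. x = foldr (\<lambda>b y. c b *\<^sub>R b + y) bs 0"
    using finite_spanning_list by blast
  have "foldr (\<lambda>b y. c b *\<^sub>R b + y) as 0 \<in> span (set bs)" if "set as \<subseteq> set bs" for c as
    using that by (induction as) (auto intro: span_add span_scale span_base span_zero)
  with bs have "span (set bs) = UNIV" by (metis UNIV_eq_I subset_refl)
  then show ?thesis by blast
qed

lemma spanning_list_if_span:
  fixes B :: "'a::real_vector set"
  assumes "finite B" "span B = UNIV"
  shows "\<exists>bs::'a list. \<forall>x. \<exists>c. x = foldr (\<lambda>b y. c b *\<^sub>R b + y) bs 0"
proof -
  obtain bs where bs: "set bs = B" "distinct bs" using finite_distinct_list[OF assms(1)] by blast
  have "\<exists>c. x = foldr (\<lambda>b y. c b *\<^sub>R b + y) bs 0" for x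
  proof -
    have "x \<in> range (\<lambda>c. \<Sum>b\<in>B. c b *\<^sub>R b)"
      using assms(2) unfolding span_finite[OF assms(1)] by simp
    then show ?thesis by (auto simp: foldr_scaleR_eq_sum[OF bs(2)] bs(1))
  qed
  then show ?thesis by blast
qed

instance euclidean_space \<subseteq> finite_dim_normed
  by standard (rule spanning_list_if_span[OF finite_Basis span_Basis])

instance prod :: (finite_dim_normed, finite_dim_normed) finite_dim_normed
proof
  obtain B :: "'a set" where B: "finite B" "span B = UNIV" using finite_dim by blast
  obtain C :: "'b set" where C: "finite C" "span C = UNIV" using finite_dim by blast
  let ?f = "\<lambda>x::'a. (x, 0::'b)" and ?g = "\<lambda>y::'b. (0::'a, y)"
  let ?D = "?f ` B \<union> ?g ` C"
  have f: "linear ?f" and g: "linear ?g" by (auto intro!: linearI)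
  have "z \<in> span ?D" for z
  proof -
    have "?f (fst z) \<in> span (?f ` B)" using linear_span_image[OF f, of B] B by blast
    moreover have "?g (snd z) \<in> span (?g ` C)" using linear_span_image[OF g, of C] C by blast
    ultimately have "?f (fst z) + ?g (snd z) \<in> span ?D"
      by (meson Un_upper1 Un_upper2 in_mono span_add span_mono)
    then show ?thesis by simp
  qed
  then have "span ?D = UNIV" by blast
  moreover have "finite ?D" using B C by simp
  ultimately show "\<exists>bs::('a \<times> 'b) list. \<forall>x. \<exists>c. x = foldr (\<lambda>b y. c b *\<^sub>R b + y) bs 0"
    by (rule spanning_list_if_span[rotated])
qed

instantiation unit :: real_normed_vector
begin
definition zero_unit :: unit where "zero_unit = ()"
definition plus_unit :: "unit \<Rightarrow> unit \<Rightarrow> unit" where "plus_unit x y = ()"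
definition scaleR_unit :: "real \<Rightarrow> unit \<Rightarrow> unit" where "scaleR_unit r x = ()"
definition norm_unit :: "unit \<Rightarrow> real" where "norm_unit x = 0"
definition dist_unit :: "unit \<Rightarrow> unit \<Rightarrow> real" where "dist_unit x y = 0"
definition sgn_unit :: "unit \<Rightarrow> unit" where "sgn_unit x = ()"
definition uniformity_unit :: "(unit \<times> unit) filter"
  where "uniformity_unit = (INF e\<in>{0<..}. principal {(x, y). dist x y < e})"
definition open_unit :: "unit set \<Rightarrow> bool"
  where "open_unit U = (\<forall>x\<in>U. eventually (\<lambda>(x', y). x' = x \<longrightarrow> y \<in> U) uniformity)"
instance
  by standard (simp_all add: norm_unit_def dist_unit_def uniformity_unit_def open_unit_def)
end

instance unit :: finite_dim_normed
proof
  show "\<exists>B::unit set set. countable B \<and> open = generate_topology B"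
  proof (intro exI[of _ UNIV] conjI ext iffI)
    fix U :: "unit set"
    have "U = {} \<or> U = UNIV" by auto
    then show "open U" by auto
    show "generate_topology UNIV U" by (simp add: generate_topology.Basis)
  qed (auto intro: countable_finite)
  show "\<exists>bs::unit list. \<forall>x. \<exists>c. x = foldr (\<lambda>b y. c b *\<^sub>R b + y) bs 0"
    by simp
qed

definition model_basis :: "'a::finite_dim_normed list"
  where "model_basis = (SOME bs. distinct bs \<and> independent (set bs) \<and> span (set bs) = UNIV)"

text \<open>Lebesgue measure on the model space, normalized so that the parallelepiped spanned by
  \<^const>\<open>model_basis\<close> has volume 1.\<close>

definition model_measure :: "'a::finite_dim_normed measure"
  where "model_measure =
    distr (PiM {..<length (model_basis :: 'a list)} (\<lambda>_. lborel)) borel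
      (\<lambda>x. \<Sum>i<length (model_basis :: 'a list). x i *\<^sub>R model_basis ! i)"

subsection \<open>Complex vector spaces and complex lines\<close>

class scaleC = scaleR +
  fixes scaleC :: "complex \<Rightarrow> 'a \<Rightarrow> 'a" (infixr \<open>*\<^sub>C\<close> 75)
  assumes scaleR_scaleC: "scaleR r = scaleC (complex_of_real r)"

class complex_vector = scaleC + ab_group_add +
  assumes scaleC_add_right: "a *\<^sub>C (x + y) = a *\<^sub>C x + a *\<^sub>C y"
    and scaleC_add_left: "(a + b) *\<^sub>C x = a *\<^sub>C x + b *\<^sub>C x"
    and scaleC_scaleC: "a *\<^sub>C b *\<^sub>C x = (a * b) *\<^sub>C x"
    and scaleC_one: "1 *\<^sub>C x = x"

subclass (in complex_vector) real_vector
  by standard (simp_all add: scaleR_scaleC scaleC_add_right scaleC_add_left scaleC_scaleC scaleC_one)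

instantiation complex :: complex_vector
begin
definition scaleC_complex :: "complex \<Rightarrow> complex \<Rightarrow> complex" where "scaleC_complex a x = a * x"
instance by standard (auto simp: scaleC_complex_def algebra_simps scaleR_conv_of_real fun_eq_iff)
end

instantiation "fun" :: (type, real_vector) real_vector
begin
definition scaleR_fun :: "real \<Rightarrow> ('a \<Rightarrow> 'b) \<Rightarrow> 'a \<Rightarrow> 'b" where "scaleR_fun r f = (\<lambda>x. r *\<^sub>R f x)"
instance by standard (simp_all add: scaleR_fun_def fun_eq_iff algebra_simps)
end

instantiation "fun" :: (type, complex_vector) complex_vector
begin
definition scaleC_fun :: "complex \<Rightarrow> ('a \<Rightarrow> 'b) \<Rightarrow> 'a \<Rightarrow> 'b" where "scaleC_fun a f = (\<lambda>x. a *\<^sub>C f x)"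
instance by standard
  (simp_all add: scaleC_fun_def scaleR_fun_def fun_eq_iff scaleR_scaleC scaleC_add_right
    scaleC_add_left scaleC_scaleC scaleC_one)
end

definition complex_line :: "'l::complex_vector set \<Rightarrow> bool"
  where "complex_line V \<longleftrightarrow> (\<exists>e. e \<noteq> 0 \<and> V = range (\<lambda>c. c *\<^sub>C e))"

lemma complex_line_add: "u + w \<in> V" if "complex_line V" "u \<in> V" "w \<in> V"
  using that by (auto simp: complex_line_def scaleC_add_left[symmetric])

lemma complex_line_scaleC: "c *\<^sub>C u \<in> V" if "complex_line V" "u \<in> V"
  using that by (auto simp: complex_line_def scaleC_scaleC)

text \<open>The coefficient of \<open>u\<close> with respect to the basis \<open>e\<close> of a complex line.\<close>

definition line_coeff :: "'l::complex_vector \<Rightarrow> 'l \<Rightarrow> complex"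
  where "line_coeff e u = (THE c. u = c *\<^sub>C e)"

definition line_basis :: "'l::complex_vector set \<Rightarrow> 'l"
  where "line_basis V = (SOME e. e \<in> V \<and> e \<noteq> 0)"

text \<open>Functionals on a subspace \<open>V\<close> are extended by 0 outside \<open>V\<close>, so that they form a subspace
  of the function space.\<close>

definition dual_space :: "'l::complex_vector set \<Rightarrow> ('l \<Rightarrow> complex) set"
  where "dual_space V = {f. (\<forall>u\<in>V. \<forall>w\<in>V. f (u + w) = f u + f w) \<and>
    (\<forall>c. \<forall>u\<in>V. f (c *\<^sub>C u) = c * f u) \<and> (\<forall>u. u \<notin> V \<longrightarrow> f u = 0)}"

definition dual_vector :: "'l::complex_vector set \<Rightarrow> 'l \<Rightarrow> 'l \<Rightarrow> complex"
  where "dual_vector V e = (\<lambda>u. if u \<in> V then line_coeff e u else 0)"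

definition bilinear_on ::
    "'l::complex_vector set \<Rightarrow> 'k::complex_vector set \<Rightarrow> ('l \<Rightarrow> 'k \<Rightarrow> complex) \<Rightarrow> bool"
  where "bilinear_on V W B \<longleftrightarrow>
    (\<forall>u\<in>V. \<forall>u'\<in>V. \<forall>w\<in>W. B (u + u') w = B u w + B u' w) \<and>
    (\<forall>u\<in>V. \<forall>w\<in>W. \<forall>w'\<in>W. B u (w + w') = B u w + B u w') \<and>
    (\<forall>c. \<forall>u\<in>V. \<forall>w\<in>W. B (c *\<^sub>C u) w = c * B u w \<and> B u (c *\<^sub>C w) = c * B u w)"

text \<open>\<open>V \<otimes> W\<close> is realized inside the dual of the space of bilinear functionals on \<open>V \<times> W\<close>:
  \<open>u \<otimes> w\<close> is evaluation at \<open>(u, w)\<close>.\<close>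

type_synonym ('l, 'k) tensor = "('l \<Rightarrow> 'k \<Rightarrow> complex) \<Rightarrow> complex"

definition tensor :: "'l::complex_vector set \<Rightarrow> 'k::complex_vector set \<Rightarrow> 'l \<Rightarrow> 'k \<Rightarrow> ('l, 'k) tensor"
  where "tensor V W u w = (\<lambda>B. if bilinear_on V W B then B u w else 0)"

text \<open>As \<open>V\<close> and \<open>W\<close> are lines, every element of \<open>V \<otimes> W\<close> is decomposable.\<close>

definition tensor_space :: "'l::complex_vector set \<Rightarrow> 'k::complex_vector set \<Rightarrow> ('l, 'k) tensor set"
  where "tensor_space V W = {tensor V W u w |u w. u \<in> V \<and> w \<in> W}"

text \<open>The contraction \<open>(U \<otimes> V\<^sup>*) \<otimes> (V \<otimes> W) \<rightarrow> U \<otimes> W\<close>, evaluated at a bilinear functional \<open>B\<close>;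
  see \<open>contraction_tensor\<close> below for its action on decomposable tensors.\<close>

definition contraction :: "'u::complex_vector set \<Rightarrow> 'w::complex_vector set \<Rightarrow>
    (('u, 'v \<Rightarrow> complex) tensor, ('v, 'w) tensor) tensor \<Rightarrow> ('u, 'w) tensor"
  where "contraction U W t = (\<lambda>B. if bilinear_on U W B
    then t (\<lambda>p q. p (\<lambda>u f. q (\<lambda>v w. f v * B u w))) else 0)"

lemma contraction_tensor:
  fixes U :: "'u::complex_vector set" and V :: "'v::complex_vector set" and W :: "'w::complex_vector set"
  assumes U: "complex_line U" and "u \<in> U" "f \<in> dual_space V" "v \<in> V" "w \<in> W"
  shows "contraction U W (tensor (tensor_space U (dual_space V)) (tensor_space V W)
      (tensor U (dual_space V) u f) (tensor V W v w)) = f v *\<^sub>C tensor U W u w"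
proof
  fix B
  show "contraction U W (tensor (tensor_space U (dual_space V)) (tensor_space V W)
      (tensor U (dual_space V) u f) (tensor V W v w)) B = (f v *\<^sub>C tensor U W u w) B"
  proof (cases "bilinear_on U W B")
    case True
    have 1: "bilinear_on V W (\<lambda>v w. f v * B u w)" if "u \<in> U" "f \<in> dual_space V" for u f
      using True that by (auto simp: bilinear_on_def dual_space_def algebra_simps)
    have 2: "bilinear_on U (dual_space V) (\<lambda>u f. q (\<lambda>v w. f v * B u w))"
      if q_in: "q \<in> tensor_space V W" for q
    proof -
      obtain v w where q: "q = tensor V W v w" and vw: "v \<in> V" "w \<in> W"
        using q_in unfolding tensor_space_def by blast
      have add: "f + g \<in> dual_space V" and scale: "c *\<^sub>C f \<in> dual_space V"
        if "f \<in> dual_space V" "g \<in> dual_space V" for f g :: "'v \<Rightarrow> complex" and c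
        using that by (auto simp: dual_space_def scaleC_fun_def scaleC_complex_def algebra_simps)
      have q': "q (\<lambda>v w. f v * B u w) = f v * B u w" if "u \<in> U" "f \<in> dual_space V" for u f
        using 1[OF that] by (simp add: q tensor_def)
      show ?thesis
        unfolding bilinear_on_def
      proof (intro conjI ballI allI)
        fix a a' f assume "a \<in> U" "a' \<in> U" "f \<in> dual_space V"
        have "B (a + a') w = B a w + B a' w"
          using True vw \<open>a \<in> U\<close> \<open>a' \<in> U\<close> by (simp add: bilinear_on_def)
        then show "q (\<lambda>v w. f v * B (a + a') w) = q (\<lambda>v w. f v * B a w) + q (\<lambda>v w. f v * B a' w)"
          using complex_line_add[OF U] \<open>a \<in> U\<close> \<open>a' \<in> U\<close> \<open>f \<in> _\<close>
          by (simp add: q' algebra_simps)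
      next
        fix a f g assume "a \<in> U" "f \<in> dual_space V" "g \<in> dual_space V"
        then show "q (\<lambda>v w. (f + g) v * B a w) = q (\<lambda>v w. f v * B a w) + q (\<lambda>v w. g v * B a w)"
          using q'[OF \<open>a \<in> U\<close> add[of f g]] by (simp add: q' algebra_simps)
      next
        fix c a f assume "a \<in> U" "f \<in> dual_space V"
        have "B (c *\<^sub>C a) w = c * B a w"
          using True vw \<open>a \<in> U\<close> by (simp add: bilinear_on_def)
        then show "q (\<lambda>v w. f v * B (c *\<^sub>C a) w) = c * q (\<lambda>v w. f v * B a w)"
          using complex_line_scaleC[OF U] \<open>a \<in> U\<close> \<open>f \<in> _\<close> by (simp add: q')
        show "q (\<lambda>v w. (c *\<^sub>C f) v * B a w) = c * q (\<lambda>v w. f v * B a w)"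
          using q'[OF \<open>a \<in> U\<close> scale[of f f c]] \<open>a \<in> U\<close> \<open>f \<in> _\<close>
          by (simp add: q' scaleC_fun_def scaleC_complex_def)
      qed
    qed
    have 3: "bilinear_on (tensor_space U (dual_space V)) (tensor_space V W)
        (\<lambda>p q. p (\<lambda>u f. q (\<lambda>v w. f v * B u w)))"
      unfolding bilinear_on_def
    proof (intro conjI ballI allI)
      fix p q q' assume p: "p \<in> tensor_space U (dual_space V)"
        and q: "q \<in> tensor_space V W" "q' \<in> tensor_space V W"
      have "bilinear_on U (dual_space V) (\<lambda>u f. (q + q') (\<lambda>v w. f v * B u w))"
        using 2[OF q(1)] 2[OF q(2)] by (auto simp: bilinear_on_def algebra_simps)
      then show "p (\<lambda>u f. (q + q') (\<lambda>v w. f v * B u w)) =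
          p (\<lambda>u f. q (\<lambda>v w. f v * B u w)) + p (\<lambda>u f. q' (\<lambda>v w. f v * B u w))"
        using p 2[OF q(1)] 2[OF q(2)] by (auto simp: tensor_space_def tensor_def)
    next
      fix c p q assume p: "p \<in> tensor_space U (dual_space V)" and q: "q \<in> tensor_space V W"
      have "bilinear_on U (dual_space V) (\<lambda>u f. (c *\<^sub>C q) (\<lambda>v w. f v * B u w))"
        using 2[OF q]
        by (auto simp: bilinear_on_def scaleC_fun_def scaleC_complex_def algebra_simps)
      then show "p (\<lambda>u f. (c *\<^sub>C q) (\<lambda>v w. f v * B u w)) = c * p (\<lambda>u f. q (\<lambda>v w. f v * B u w))"
        using p 2[OF q]
        by (auto simp: tensor_space_def tensor_def scaleC_fun_def scaleC_complex_def)
    qed (auto simp: scaleC_fun_def scaleC_complex_def)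
    let ?q = "tensor V W v w"
    have q: "?q \<in> tensor_space V W" and p: "tensor U (dual_space V) u f \<in> tensor_space U (dual_space V)"
      using assms unfolding tensor_space_def by blast+
    have "contraction U W (tensor (tensor_space U (dual_space V)) (tensor_space V W)
        (tensor U (dual_space V) u f) ?q) B =
      tensor U (dual_space V) u f (\<lambda>u f. ?q (\<lambda>v w. f v * B u w))"
      using True 3 by (simp add: contraction_def tensor_def[of "tensor_space U (dual_space V)"])
    also have "\<dots> = ?q (\<lambda>v w. f v * B u w)"
      using 2[OF q] by (simp add: tensor_def[of U])
    also have "\<dots> = f v * B u w"
      using 1 assms by (simp add: tensor_def)
    finally show ?thesis
      using True by (simp add: tensor_def[of U] scaleC_fun_def scaleC_complex_def)
  next
    case False
    then show ?thesis
      by (simp add: contraction_def tensor_def scaleC_fun_def scaleC_complex_def)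
  qed
qed

section \<open>Manifolds\<close>

primrec Ck_on :: "nat \<Rightarrow> 'a::real_normed_vector set \<Rightarrow> ('a \<Rightarrow> 'b::real_normed_vector) \<Rightarrow> bool"
  where
    "Ck_on 0 S f \<longleftrightarrow> continuous_on S f"
  | "Ck_on (Suc k) S f \<longleftrightarrow> (\<forall>x\<in>S. f differentiable (at x)) \<and>
      (\<forall>v. Ck_on k S (\<lambda>x. frechet_derivative f (at x) v))"

definition smooth_on :: "'a::real_normed_vector set \<Rightarrow> ('a \<Rightarrow> 'b::real_normed_vector) \<Rightarrow> bool"
  where "smooth_on S f \<longleftrightarrow> (\<forall>k. Ck_on k S f)"

text \<open>A chart \<open>(U, \<phi>)\<close> consists of its domain and its coordinate map. The underlying set of a
  manifold is a whole type \<open>'m\<close>.\<close>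

type_synonym ('m, 'a) chart = "'m set \<times> ('m \<Rightarrow> 'a)"

definition chart_inv :: "('m, 'a) chart \<Rightarrow> 'a \<Rightarrow> 'm"
  where "chart_inv c = inv_into (fst c) (snd c)"

definition smooth_atlas :: "('m::topological_space, 'a::finite_dim_normed) chart set \<Rightarrow> bool"
  where "smooth_atlas A \<longleftrightarrow>
    (\<forall>c\<in>A. open (fst c) \<and> open (snd c ` fst c) \<and>
      homeomorphism (fst c) (snd c ` fst c) (snd c) (chart_inv c)) \<and>
    (\<Union>c\<in>A. fst c) = UNIV \<and>
    (\<forall>c\<in>A. \<forall>d\<in>A. smooth_on (snd c ` (fst c \<inter> fst d)) (snd d \<circ> chart_inv c))"

definition smooth_fun ::
    "('m, 'a::finite_dim_normed) chart set \<Rightarrow> 'm set \<Rightarrow> ('m \<Rightarrow> 'b::real_normed_vector) \<Rightarrow> bool"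
  where "smooth_fun A W f \<longleftrightarrow> (\<forall>c\<in>A. smooth_on (snd c ` (fst c \<inter> W)) (f \<circ> chart_inv c))"

definition some_chart :: "('m, 'a) chart set \<Rightarrow> 'm \<Rightarrow> ('m, 'a) chart"
  where "some_chart A x = (SOME c. c \<in> A \<and> x \<in> fst c)"

text \<open>A tangent vector is given by its components in all charts around the base point, subject to
  the usual transformation rule; its value at the remaining charts is 0.\<close>

type_synonym ('m, 'a) tangent = "('m, 'a) chart \<Rightarrow> 'a"

definition tangent_space ::
    "('m, 'a::finite_dim_normed) chart set \<Rightarrow> 'm \<Rightarrow> ('m, 'a) tangent set"
  where "tangent_space A x = {v.
    (\<forall>c\<in>A. \<forall>d\<in>A. x \<in> fst c \<inter> fst d \<longrightarrow>
      v d = frechet_derivative (snd d \<circ> chart_inv c) (at (snd c x)) (v c)) \<and>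
    (\<forall>c. \<not> (c \<in> A \<and> x \<in> fst c) \<longrightarrow> v c = 0)}"

text \<open>The tangent vector at \<open>x\<close> with components \<open>a\<close> in the chart \<open>c\<close>.\<close>

definition coord_vec ::
    "('m, 'a::finite_dim_normed) chart set \<Rightarrow> ('m, 'a) chart \<Rightarrow> 'm \<Rightarrow> 'a \<Rightarrow> ('m, 'a) tangent"
  where "coord_vec A c x a = (\<lambda>d. if d \<in> A \<and> x \<in> fst d
    then frechet_derivative (snd d \<circ> chart_inv c) (at (snd c x)) a else 0)"

definition differential ::
    "('m, 'a::finite_dim_normed) chart set \<Rightarrow> ('n, 'b::finite_dim_normed) chart set \<Rightarrow>
     ('m \<Rightarrow> 'n) \<Rightarrow> 'm \<Rightarrow> ('m, 'a) tangent \<Rightarrow> ('n, 'b) tangent"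
  where "differential A B F x v = (let c = some_chart A x in
    (\<lambda>d. if d \<in> B \<and> F x \<in> fst d
      then frechet_derivative (snd d \<circ> F \<circ> chart_inv c) (at (snd c x)) (v c) else 0))"

definition dir_deriv ::
    "('m, 'a::finite_dim_normed) chart set \<Rightarrow> 'm \<Rightarrow> ('m, 'a) tangent \<Rightarrow>
     ('m \<Rightarrow> 'b::real_normed_vector) \<Rightarrow> 'b"
  where "dir_deriv A x v f = (let c = some_chart A x in
    frechet_derivative (f \<circ> chart_inv c) (at (snd c x)) (v c))"

definition prod_atlas ::
    "('m, 'a) chart set \<Rightarrow> ('n, 'b) chart set \<Rightarrow> ('m \<times> 'n, 'a \<times> 'b) chart set"
  where "prod_atlas A B = {(fst c \<times> fst d, map_prod (snd c) (snd d)) |c d. c \<in> A \<and> d \<in> B}"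

section \<open>Differential forms\<close>

subsection \<open>Alternating forms, wedge product, pullback\<close>

text \<open>
  A form is evaluated on a list of tangent vectors. Its component of degree \<open>k\<close> is its restriction
  to lists of length \<open>k\<close>; thus one such function is an element of the direct sum over all degrees.
  Forms vanish on lists which contain a vector that is not tangent at the base point, so that
  forms are equal iff they agree as functions.
\<close>

type_synonym ('m, 'a, 'v) form = "'m \<Rightarrow> ('m, 'a) tangent list \<Rightarrow> 'v"

definition alternating_on :: "'t::real_vector set \<Rightarrow> ('t list \<Rightarrow> 'v::real_vector) \<Rightarrow> bool"
  where "alternating_on T f \<longleftrightarrow>
    (\<forall>us vs v w r. set us \<union> set vs \<union> {v, w} \<subseteq> T \<longrightarrow>
      f (us @ (v + w) # vs) = f (us @ v # vs) + f (us @ w # vs) \<and>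
      f (us @ (r *\<^sub>R v) # vs) = r *\<^sub>R f (us @ v # vs)) \<and>
    (\<forall>vs. set vs \<subseteq> T \<and> \<not> distinct vs \<longrightarrow> f vs = 0) \<and>
    (\<forall>vs. \<not> set vs \<subseteq> T \<longrightarrow> f vs = 0)"

definition homogeneous :: "nat \<Rightarrow> ('m, 'a, 'v::zero) form \<Rightarrow> bool"
  where "homogeneous k \<omega> \<longleftrightarrow> (\<forall>x vs. length vs \<noteq> k \<longrightarrow> \<omega> x vs = 0)"

definition real_forms :: "('m, 'a::finite_dim_normed) chart set \<Rightarrow> ('m, 'a, real) form set"
  where "real_forms A = {\<omega>. (\<forall>x. alternating_on (tangent_space A x) (\<omega> x)) \<and>
    (\<forall>c\<in>A. \<forall>as. smooth_fun A (fst c) (\<lambda>x. \<omega> x (map (coord_vec A c x) as)))}"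

text \<open>Sign of the permutation of \<open>{0..<k}\<close> which lists the elements of \<open>S\<close> in increasing order,
  followed by the remaining ones in increasing order.\<close>

definition shuffle_sign :: "nat \<Rightarrow> nat set \<Rightarrow> real"
  where "shuffle_sign k S = (-1) ^ card {(i, j). i \<in> S \<and> j \<in> {..<k} - S \<and> j < i}"

text \<open>The wedge product followed by a fibrewise bilinear pairing \<open>B\<close> of the values, as a sum over
  shuffles. The sum over all subsets comprises all bidegrees.\<close>

definition wedge :: "('m \<Rightarrow> 'u \<Rightarrow> 'v \<Rightarrow> 'w) \<Rightarrow> ('m, 'a, 'u) form \<Rightarrow> ('m, 'a, 'v) form \<Rightarrow>
    ('m, 'a, 'w::real_vector) form"
  where "wedge B \<alpha> \<beta> = (\<lambda>x vs. \<Sum>S\<in>Pow {..<length vs}.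
    shuffle_sign (length vs) S *\<^sub>R B x (\<alpha> x (nths vs S)) (\<beta> x (nths vs (- S))))"

abbreviation scalar_wedge ::
    "('m, 'a, real) form \<Rightarrow> ('m, 'a, 'v::real_vector) form \<Rightarrow> ('m, 'a, 'v) form"
  where "scalar_wedge \<equiv> wedge (\<lambda>_. scaleR)"

primrec wedge_power :: "('m, 'a, real) form \<Rightarrow> nat \<Rightarrow> ('m, 'a, real) form"
  where
    "wedge_power \<omega> 0 = (\<lambda>x vs. if vs = [] then 1 else 0)"
  | "wedge_power \<omega> (Suc n) = scalar_wedge \<omega> (wedge_power \<omega> n)"

definition pullback ::
    "('m, 'a::finite_dim_normed) chart set \<Rightarrow> ('n, 'b::finite_dim_normed) chart set \<Rightarrow>
     ('m \<Rightarrow> 'n) \<Rightarrow> ('n, 'b, 'v::zero) form \<Rightarrow> ('m, 'a, 'v) form"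
  where "pullback A B F \<omega> = (\<lambda>x vs. if set vs \<subseteq> tangent_space A x
    then \<omega> (F x) (map (differential A B F x) vs) else 0)"

text \<open>
  The exterior derivative twisted by a covariant derivative \<open>D x v s\<close> (of \<open>s\<close> at \<open>x\<close> in direction
  \<open>v\<close>), by the Koszul formula for vector fields with constant components in some chart around
  \<open>x\<close>; the terms with Lie brackets vanish.
\<close>

definition ext_deriv ::
    "('m, 'a::finite_dim_normed) chart set \<Rightarrow>
     ('m \<Rightarrow> ('m, 'a) tangent \<Rightarrow> ('m \<Rightarrow> 'v) \<Rightarrow> 'v) \<Rightarrow>
     ('m, 'a, 'v) form \<Rightarrow> ('m, 'a, 'v::real_vector) form"
  where "ext_deriv A D \<omega> = (\<lambda>x vs. let c = some_chart A x in
    if set vs \<subseteq> tangent_space A x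
    then \<Sum>i<length vs. (-1) ^ i *\<^sub>R D x (vs ! i)
      (\<lambda>y. \<omega> y (map (\<lambda>v. coord_vec A c y (v c)) (take i vs @ drop (Suc i) vs)))
    else 0)"

definition symplectic_form ::
    "('m, 'a::finite_dim_normed) chart set \<Rightarrow> ('m, 'a, real) form \<Rightarrow> bool"
  where "symplectic_form A \<omega> \<longleftrightarrow> \<omega> \<in> real_forms A \<and> homogeneous 2 \<omega> \<and>
    ext_deriv A (dir_deriv A) \<omega> = 0 \<and>
    (\<forall>x. \<forall>v\<in>tangent_space A x. (\<forall>w\<in>tangent_space A x. \<omega> x [v, w] = 0) \<longrightarrow> v = 0)"

subsection \<open>Integration\<close>

definition partition_of_unity ::
    "('m::topological_space, 'a::finite_dim_normed) chart set \<Rightarrow>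
     (('m, 'a) chart \<times> ('m \<Rightarrow> real)) set \<Rightarrow> bool"
  where "partition_of_unity A P \<longleftrightarrow> finite P \<and>
    (\<forall>(c, \<rho>)\<in>P. c \<in> A \<and> smooth_fun A UNIV \<rho> \<and> (\<forall>x. \<rho> x \<ge> 0) \<and> closure {x. \<rho> x \<noteq> 0} \<subseteq> fst c) \<and>
    (\<forall>x. (\<Sum>(c, \<rho>)\<in>P. \<rho> x) = 1)"

text \<open>
  Integral of a complex-valued form of top degree over the domain of the chart \<open>c\<close>, after
  multiplication by \<open>\<rho>\<close>. The coordinate frame need not be positively oriented: the sign of the
  symplectic volume form on it corrects for this (and for the order of \<^const>\<open>model_basis\<close>).
\<close>

definition chart_integral ::
    "('m, 'a::finite_dim_normed) chart set \<Rightarrow> ('m, 'a, real) form \<Rightarrow> ('m, 'a) chart \<Rightarrow>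
     ('m \<Rightarrow> real) \<Rightarrow> ('m, 'a, complex) form \<Rightarrow> complex"
  where "chart_integral A \<omega> c \<rho> \<tau> =
    (LINT y:snd c ` fst c|model_measure.
      (let x = chart_inv c y; bs = map (coord_vec A c x) model_basis in
        (\<rho> x * sgn (wedge_power \<omega> (length bs div 2) x bs)) *\<^sub>R \<tau> x bs))"

text \<open>Integral over a compact manifold with the orientation given by the symplectic form \<open>\<omega>\<close>.
  On a compact manifold a finite partition of unity exists, and the value does not depend on it.\<close>

definition symplectic_integral ::
    "('m::topological_space, 'a::finite_dim_normed) chart set \<Rightarrow> ('m, 'a, real) form \<Rightarrow>
     ('m, 'a, complex) form \<Rightarrow> complex"
  where "symplectic_integral A \<omega> \<tau> = (if \<exists>P. partition_of_unity A P
    then \<Sum>(c, \<rho>)\<in>(SOME P. partition_of_unity A P). chart_integral A \<omega> c \<rho> \<tau> else 0)"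

definition line_integral ::
    "('m::topological_space, 'a::finite_dim_normed) chart set \<Rightarrow> ('m, 'a, real) form \<Rightarrow>
     'l::complex_vector set \<Rightarrow> ('m, 'a, 'l) form \<Rightarrow> 'l"
  where "line_integral A \<omega> V \<tau> =
    symplectic_integral A \<omega> (\<lambda>x vs. line_coeff (line_basis V) (\<tau> x vs)) *\<^sub>C line_basis V"

section \<open>Line bundles and connections\<close>

text \<open>
  The fibres of a line bundle are complex lines in some complex vector space \<open>'l\<close>. This does not
  restrict generality: every family of lines embeds fibrewise into a suitable \<open>'l\<close>, and elements
  of different fibres are never compared. The smooth structure
  is given by a family of nowhere vanishing local sections \<open>(U, s)\<close> with smooth transition functions.
\<close>

record ('m, 'l) line_bundle =
  fib :: "'m \<Rightarrow> 'l set"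
  frames :: "('m set \<times> ('m \<Rightarrow> 'l)) set"

definition is_line_bundle ::
    "('m::topological_space, 'a::finite_dim_normed) chart set \<Rightarrow>
     ('m, 'l::complex_vector) line_bundle \<Rightarrow> bool"
  where "is_line_bundle A E \<longleftrightarrow>
    (\<forall>x. complex_line (fib E x)) \<and>
    (\<forall>(U, s)\<in>frames E. open U \<and> (\<forall>x\<in>U. s x \<in> fib E x \<and> s x \<noteq> 0)) \<and>
    (\<Union>(U, s)\<in>frames E. U) = UNIV \<and>
    (\<forall>(U, s)\<in>frames E. \<forall>(V, t)\<in>frames E. smooth_fun A (U \<inter> V) (\<lambda>x. line_coeff (s x) (t x)))"

definition some_frame :: "('m, 'l) line_bundle \<Rightarrow> 'm \<Rightarrow> 'm \<Rightarrow> 'l"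
  where "some_frame E x = snd (SOME (U, s). (U, s) \<in> frames E \<and> x \<in> U)"

definition smooth_section ::
    "('m, 'a::finite_dim_normed) chart set \<Rightarrow> ('m, 'l::complex_vector) line_bundle \<Rightarrow>
     'm set \<Rightarrow> ('m \<Rightarrow> 'l) \<Rightarrow> bool"
  where "smooth_section A E W t \<longleftrightarrow> (\<forall>x\<in>W. t x \<in> fib E x) \<and>
    (\<forall>(U, s)\<in>frames E. smooth_fun A (U \<inter> W) (\<lambda>x. line_coeff (s x) (t x)))"

definition bundle_forms ::
    "('m, 'a::finite_dim_normed) chart set \<Rightarrow> ('m, 'l::complex_vector) line_bundle \<Rightarrow>
     ('m, 'a, 'l) form set"
  where "bundle_forms A E = {\<xi>.
    (\<forall>x. alternating_on (tangent_space A x) (\<xi> x)) \<and> (\<forall>x vs. \<xi> x vs \<in> fib E x) \<and>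
    (\<forall>c\<in>A. \<forall>as. smooth_section A E (fst c) (\<lambda>x. \<xi> x (map (coord_vec A c x) as)))}"

type_synonym ('m, 'l) metric = "'m \<Rightarrow> 'l \<Rightarrow> 'l \<Rightarrow> complex"

definition hermitian_metric ::
    "('m, 'a::finite_dim_normed) chart set \<Rightarrow> ('m, 'l::complex_vector) line_bundle \<Rightarrow>
     ('m, 'l) metric \<Rightarrow> bool"
  where "hermitian_metric A E h \<longleftrightarrow>
    (\<forall>x. \<forall>u\<in>fib E x. \<forall>v\<in>fib E x. \<forall>w\<in>fib E x. \<forall>c.
      h x (u + v) w = h x u w + h x v w \<and> h x (c *\<^sub>C u) w = c * h x u w \<and>
      h x w u = cnj (h x u w) \<and> (u \<noteq> 0 \<longrightarrow> Re (h x u u) > 0)) \<and>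
    (\<forall>(U, s)\<in>frames E. smooth_fun A U (\<lambda>x. h x (s x) (s x)))"

text \<open>A connection \<open>D\<close> is given by the covariant derivatives \<open>D x v s\<close> of local smooth sections.\<close>

type_synonym ('m, 'a, 'l) connection = "'m \<Rightarrow> ('m, 'a) tangent \<Rightarrow> ('m \<Rightarrow> 'l) \<Rightarrow> 'l"

definition unitary_connection ::
    "('m::topological_space, 'a::finite_dim_normed) chart set \<Rightarrow>
     ('m, 'l::complex_vector) line_bundle \<Rightarrow> ('m, 'l) metric \<Rightarrow> ('m, 'a, 'l) connection \<Rightarrow> bool"
  where "unitary_connection A E h D \<longleftrightarrow> (\<forall>W s. open W \<and> smooth_section A E W s \<longrightarrow>
    (\<forall>c\<in>A. \<forall>a. smooth_section A E (W \<inter> fst c) (\<lambda>x. D x (coord_vec A c x a) s)) \<and>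
    (\<forall>x\<in>W. \<forall>v\<in>tangent_space A x.
      D x v s \<in> fib E x \<and>
      (\<forall>w\<in>tangent_space A x. D x (v + w) s = D x v s + D x w s) \<and>
      (\<forall>r. D x (r *\<^sub>R v) s = r *\<^sub>R D x v s) \<and>
      (\<forall>t. (\<forall>y\<in>W. t y = s y) \<longrightarrow> D x v t = D x v s) \<and>
      (\<forall>f::'m \<Rightarrow> complex. smooth_fun A W f \<longrightarrow>
        D x v (\<lambda>y. f y *\<^sub>C s y) = dir_deriv A x v f *\<^sub>C s x + f x *\<^sub>C D x v s) \<and>
      (\<forall>t. smooth_section A E W t \<longrightarrow>
        D x v (\<lambda>y. s y + t y) = D x v s + D x v t \<and>
        dir_deriv A x v (\<lambda>y. h y (s y) (t y)) = h x (D x v s) (t x) + h x (s x) (D x v t))))"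

section \<open>Prequantum systems\<close>

record ('m, 'a, 'l) prequantum =
  atlas :: "('m, 'a) chart set"
  sympl :: "('m, 'a, real) form"
  lbundle :: "('m, 'l) line_bundle"
  herm :: "('m, 'l) metric"
  nabla :: "('m, 'a, 'l) connection"

definition prequantum_system ::
    "('m::{t2_space, second_countable_topology}, 'a::finite_dim_normed, 'l::complex_vector) prequantum \<Rightarrow> bool"
  where "prequantum_system X \<longleftrightarrow>
    compact (UNIV :: 'm set) \<and> connected (UNIV :: 'm set) \<and> smooth_atlas (atlas X) \<and>
    symplectic_form (atlas X) (sympl X) \<and>
    is_line_bundle (atlas X) (lbundle X) \<and>
    hermitian_metric (atlas X) (lbundle X) (herm X) \<and>
    unitary_connection (atlas X) (lbundle X) (herm X) (nabla X) \<and>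
    (\<forall>\<xi>\<in>bundle_forms (atlas X) (lbundle X).
      ext_deriv (atlas X) (nabla X) (ext_deriv (atlas X) (nabla X) \<xi>) =
      (- \<i>) *\<^sub>C scalar_wedge (sympl X) \<xi>)"

definition lefschetz ::
    "('m, 'a, 'l::complex_vector) prequantum \<Rightarrow> ('m, 'a, 'l) form \<Rightarrow> ('m, 'a, 'l) form"
  where "lefschetz X \<xi> = scalar_wedge (sympl X) \<xi>"

definition Gamma_forms ::
    "('m, 'a::finite_dim_normed, 'l::complex_vector) prequantum \<Rightarrow> ('m, 'a, 'l) form set"
  where "Gamma_forms X = {\<xi> \<in> bundle_forms (atlas X) (lbundle X). lefschetz X \<xi> = 0}"

subsection \<open>The dual system\<close>

definition dual_bundle ::
    "('m, 'l::complex_vector) line_bundle \<Rightarrow> ('m, 'l \<Rightarrow> complex) line_bundle"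
  where "dual_bundle E = \<lparr>fib = \<lambda>x. dual_space (fib E x),
    frames = {(U, \<lambda>x. dual_vector (fib E x) (s x)) |U s. (U, s) \<in> frames E}\<rparr>"

definition dual_metric ::
    "('m, 'l::complex_vector) line_bundle \<Rightarrow> ('m, 'l) metric \<Rightarrow> ('m, 'l \<Rightarrow> complex) metric"
  where "dual_metric E h x f g =
    (let e = line_basis (fib E x) in f e * cnj (g e) / h x e e)"

text \<open>\<open>(\<nabla>\<^sup>+\<^sub>v f)(u) = v(f(s)) - f(\<nabla>\<^sub>v s)\<close>, where \<open>s\<close> is a local section through \<open>u\<close>.\<close>

definition dual_connection ::
    "('m, 'a::finite_dim_normed) chart set \<Rightarrow> ('m, 'l::complex_vector) line_bundle \<Rightarrow>
     ('m, 'a, 'l) connection \<Rightarrow> ('m, 'a, 'l \<Rightarrow> complex) connection"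
  where "dual_connection A E D x v f = (\<lambda>u. if u \<in> fib E x
    then let e = some_frame E x; s = (\<lambda>y. line_coeff (e x) u *\<^sub>C e y) in
      dir_deriv A x v (\<lambda>y. f y (s y)) - f x (D x v s)
    else 0)"

definition dual_system ::
    "('m, 'a::finite_dim_normed, 'l::complex_vector) prequantum \<Rightarrow>
     ('m, 'a, 'l \<Rightarrow> complex) prequantum"
  where "dual_system X = \<lparr>atlas = atlas X, sympl = (\<lambda>x vs. - sympl X x vs),
    lbundle = dual_bundle (lbundle X), herm = dual_metric (lbundle X) (herm X),
    nabla = dual_connection (atlas X) (lbundle X) (nabla X)\<rparr>"

subsection \<open>Products\<close>

definition box_bundle ::
    "('m, 'l::complex_vector) line_bundle \<Rightarrow> ('n, 'k::complex_vector) line_bundle \<Rightarrow>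
     ('m \<times> 'n, ('l, 'k) tensor) line_bundle"
  where "box_bundle E F = \<lparr>fib = (\<lambda>(x, y). tensor_space (fib E x) (fib F y)),
    frames = {(U \<times> V, \<lambda>(x, y). tensor (fib E x) (fib F y) (s x) (t y)) |U s V t.
      (U, s) \<in> frames E \<and> (V, t) \<in> frames F}\<rparr>"

definition box_metric ::
    "('m, 'l::complex_vector) line_bundle \<Rightarrow> ('n, 'k::complex_vector) line_bundle \<Rightarrow>
     ('m, 'l) metric \<Rightarrow> ('n, 'k) metric \<Rightarrow> ('m \<times> 'n, ('l, 'k) tensor) metric"
  where "box_metric E F h g = (\<lambda>(x, y) p q.
    let e = line_basis (fib E x); f = line_basis (fib F y); b = tensor (fib E x) (fib F y) e f in
    line_coeff b p * cnj (line_coeff b q) * h x e e * g y f f)"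

text \<open>Determined by \<open>\<nabla>(\<phi> e \<otimes> f) = d\<phi> e \<otimes> f + \<phi> (\<nabla>e \<otimes> f + e \<otimes> \<nabla>f)\<close> for local frames \<open>e\<close>, \<open>f\<close>.\<close>

definition box_connection ::
    "('m, 'a::finite_dim_normed) chart set \<Rightarrow> ('n, 'b::finite_dim_normed) chart set \<Rightarrow>
     ('m, 'l::complex_vector) line_bundle \<Rightarrow> ('n, 'k::complex_vector) line_bundle \<Rightarrow>
     ('m, 'a, 'l) connection \<Rightarrow> ('n, 'b, 'k) connection \<Rightarrow>
     ('m \<times> 'n, 'a \<times> 'b, ('l, 'k) tensor) connection"
  where "box_connection A B E F D D' = (\<lambda>(x, y) v t.
    let AB = prod_atlas A B; e = some_frame E x; f = some_frame F y;
      \<phi> = (\<lambda>(x', y'). line_coeff (tensor (fib E x') (fib F y') (e x') (f y')) (t (x', y')));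
      T = tensor (fib E x) (fib F y)
    in dir_deriv AB (x, y) v \<phi> *\<^sub>C T (e x) (f y) +
      \<phi> (x, y) *\<^sub>C (T (D x (differential AB A fst (x, y) v) e) (f y) +
        T (e x) (D' y (differential AB B snd (x, y) v) f)))"

definition prod_system ::
    "('m, 'a::finite_dim_normed, 'l::complex_vector) prequantum \<Rightarrow>
     ('n, 'b::finite_dim_normed, 'k::complex_vector) prequantum \<Rightarrow>
     ('m \<times> 'n, 'a \<times> 'b, ('l, 'k) tensor) prequantum"
  where "prod_system X Y = (let A = prod_atlas (atlas X) (atlas Y) in
    \<lparr>atlas = A,
     sympl = pullback A (atlas X) fst (sympl X) + pullback A (atlas Y) snd (sympl Y),
     lbundle = box_bundle (lbundle X) (lbundle Y),
     herm = box_metric (lbundle X) (lbundle Y) (herm X) (herm Y),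
     nabla = box_connection (atlas X) (atlas Y) (lbundle X) (lbundle Y) (nabla X) (nabla Y)\<rparr>)"

subsection \<open>Composition\<close>

text \<open>
  Fibre integration along \<open>k : M \<times> N \<times> P \<rightarrow> M \<times> P\<close> of a form whose value at \<open>(m, n, p)\<close> lies in the
  line \<open>V (m, p)\<close>. The arguments \<open>ws\<close> are lifted to \<open>M \<times> N \<times> P\<close> horizontally. It is irrelevant
  whether vectors along the fibre come first or last, because the dimension of \<open>N\<close> is even.
\<close>

definition fibre_integral ::
    "('m, 'a::finite_dim_normed) chart set \<Rightarrow>
     ('n::topological_space, 'b::finite_dim_normed) chart set \<Rightarrow> ('n, 'b, real) form \<Rightarrow>
     ('p, 'c::finite_dim_normed) chart set \<Rightarrow> ('m \<times> 'p \<Rightarrow> 'l::complex_vector set) \<Rightarrow>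
     ('m \<times> 'n \<times> 'p, 'a \<times> 'b \<times> 'c, 'l) form \<Rightarrow> ('m \<times> 'p, 'a \<times> 'c, 'l) form"
  where "fibre_integral A B \<omega> C V \<beta> = (\<lambda>(m, p) ws.
    let AC = prod_atlas A C; ABC = prod_atlas A (prod_atlas B C) in
    if set ws \<subseteq> tangent_space AC (m, p)
    then line_integral B \<omega> (V (m, p)) (\<lambda>n us. \<beta> (m, n, p)
      (map (differential B ABC (\<lambda>n. (m, n, p)) n) us @
       map (differential AC ABC (\<lambda>(m, p). (m, n, p)) (m, p)) ws))
    else 0)"

definition compose_forms ::
    "('m, 'a::finite_dim_normed, 'l::complex_vector) prequantum \<Rightarrow>
     ('n::topological_space, 'b::finite_dim_normed, 'k::complex_vector) prequantum \<Rightarrow>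
     ('p, 'c::finite_dim_normed, 'j::complex_vector) prequantum \<Rightarrow>
     ('m \<times> 'n, 'a \<times> 'b, ('l, 'k \<Rightarrow> complex) tensor) form \<Rightarrow>
     ('n \<times> 'p, 'b \<times> 'c, ('k, 'j \<Rightarrow> complex) tensor) form \<Rightarrow>
     ('m \<times> 'p, 'a \<times> 'c, ('l, 'j \<Rightarrow> complex) tensor) form"
  where "compose_forms M N P \<xi> \<eta> = (
    let A = atlas M; B = atlas N; C = atlas P; ABC = prod_atlas A (prod_atlas B C);
      MN = prod_system M (dual_system N); NP = prod_system N (dual_system P);
      MP = prod_system M (dual_system P);
      \<beta> = wedge (\<lambda>(m, n, p). tensor (fib (lbundle MN) (m, n)) (fib (lbundle NP) (n, p)))
        (pullback ABC (atlas MN) (\<lambda>(m, n, p). (m, n)) \<xi>)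
        (pullback ABC (atlas NP) (\<lambda>(m, n, p). (n, p)) \<eta>)
    in fibre_integral A B (sympl N) C (fib (lbundle MP))
      (\<lambda>(m, n, p) vs. contraction (fib (lbundle M) m) (fib (lbundle (dual_system P)) p)
        (\<beta> (m, n, p) vs)))"

end

theory Submission
  imports Defs
begin

text \<open>
  As \<open>\<sigma>\<close> and \<open>\<zeta>\<close> lie in the kernels of the respective operators \<open>L\<close>, the right-hand side vanishes. On
  \<open>M \<times> N \<times> P\<close> the three two-forms are related by
  \<open>k\<^sup>*(\<omega>\<^sub>M - \<omega>\<^sub>P) = i\<^sup>*(\<omega>\<^sub>M - \<omega>\<^sub>N) + j\<^sup>*(\<omega>\<^sub>N - \<omega>\<^sub>P)\<close>. As two-forms commute with all forms, the
  wedge product of the left-hand side with \<open>i\<^sup>*\<sigma> \<and> j\<^sup>*\<zeta>\<close> vanishes. The left-hand side is pulled back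
  along \<open>k\<close>, so that it can be moved out of the fibre integral, which gives \<open>L(\<sigma> \<circ> \<zeta>) = 0\<close>. The last step
  uses linearity of the integral, whence the need for integrability: the Bochner integral is 0 on
  functions which are not integrable.
\<close>

section \<open>Wedge products of functionals on lists\<close>

text \<open>The algebra is done for arbitrary complex functionals on lists. A form is one functional
  on lists of all lengths, so "two-form" enters as vanishing on lists of odd length, and signs are
  carried by the grading automorphism. Contraction with the first argument is an antiderivation of
  the shuffle product, so associativity and commutation follow by induction on the argument list.
  Line bundles disappear pointwise: with nonzero vectors e, s, f in the fibres of
  \<open>L_M\<close>, \<open>L_N\<close>, \<open>L_P^*\<close> and the dual s^* of s, the
  contraction of e \<otimes> s^* with s \<otimes> f is e \<otimes> f, so that coefficients simply
  multiply. The step out of the fibre integral is the projection formula. For fixed (m, p) and fixed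
  arguments, the values of \<open>\<omega>_M - \<omega>_P\<close> are constants along N, so the
  claim becomes a linear relation with constant coefficients between integrals over N. Integrability
  reduces to continuity of each integrand in charts of N; only there do frames have to vary with the
  point of N, while those over M and P stay fixed.\<close>

definition list_wedge :: "('t list \<Rightarrow> complex) \<Rightarrow> ('t list \<Rightarrow> complex) \<Rightarrow> 't list \<Rightarrow> complex"
  where "list_wedge f g vs = (\<Sum>S\<in>Pow {..<length vs}.
    shuffle_sign (length vs) S *\<^sub>R (f (nths vs S) * g (nths vs (- S))))"

text \<open>The automorphism that acts on degree k by (-1)^k: the sign incurred by moving one vector
  past all arguments of f.\<close>

abbreviation grade :: "('t list \<Rightarrow> complex) \<Rightarrow> 't list \<Rightarrow> complex"
  where "grade f \<equiv> \<lambda>l. (- 1) ^ length l * f l"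

text \<open>A subset of \<open>{..<Suc n}\<close> is a shifted subset of \<open>{..<n}\<close>, with
  or without 0. This separates the shuffles by the factor that receives the first argument.\<close>

lemma sum_Pow_lessThan_Suc:
  fixes F :: "nat set \<Rightarrow> 'v::comm_monoid_add"
  shows "(\<Sum>S\<in>Pow {..<Suc n}. F S) =
    (\<Sum>S\<in>Pow {..<n}. F (insert 0 (Suc ` S))) + (\<Sum>S\<in>Pow {..<n}. F (Suc ` S))"
proof -
  let ?A = "(\<lambda>S. insert 0 (Suc ` S)) ` Pow {..<n}" and ?B = "(image Suc) ` Pow {..<n}"
  have "Pow (Suc ` {..<n}) = ?B"
    by (rule image_Pow_surj[OF refl, symmetric])
  then have un: "Pow {..<Suc n} = ?A \<union> ?B"
    unfolding lessThan_Suc_eq_insert_0 Pow_insert by (simp add: image_image Un_commute)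
  have inj: "inj_on (\<lambda>S. insert 0 (Suc ` S)) (Pow {..<n})"
    by (auto intro!: inj_onI simp: inj_image_eq_iff insert_ident)
  have "sum F (?A \<union> ?B) = sum F ?A + sum F ?B"
    by (rule sum.union_disjoint) auto
  then show ?thesis
    unfolding un by (simp add: sum.reindex[OF inj] sum.reindex inj_on_def inj_image_eq_iff)
qed

text \<open>The index 0 is listed first already, so it takes part in no inversion.\<close>

lemma shuffle_sign_insert_0:
  assumes "S \<subseteq> {..<n}"
  shows "shuffle_sign (Suc n) (insert 0 (Suc ` S)) = shuffle_sign n S"
proof -
  have "{(i, j). i \<in> insert 0 (Suc ` S) \<and> j \<in> {..<Suc n} - insert 0 (Suc ` S) \<and> j < i} =
    map_prod Suc Suc ` {(i, j). i \<in> S \<and> j \<in> {..<n} - S \<and> j < i}"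
  proof (intro set_eqI iffI)
    fix z assume z: "z \<in> {(i, j). i \<in> insert 0 (Suc ` S) \<and> j \<in> {..<Suc n} - insert 0 (Suc ` S) \<and> j < i}"
    then obtain i j where "z = (Suc i, Suc j)"
      by (cases z; cases "fst z"; cases "snd z") auto
    with z show "z \<in> map_prod Suc Suc ` {(i, j). i \<in> S \<and> j \<in> {..<n} - S \<and> j < i}"
      by (auto intro!: rev_image_eqI[of "(i, j)"])
  qed auto
  moreover have "inj_on (map_prod Suc Suc) X" for X
    by (auto simp: inj_on_def)
  ultimately show ?thesis
    by (simp add: shuffle_sign_def card_image)
qed

text \<open>The index 0 is listed after every element of S, which adds \<open>card S\<close>
  inversions.\<close>

lemma shuffle_sign_image_Suc:
  assumes "S \<subseteq> {..<n}"
  shows "shuffle_sign (Suc n) (Suc ` S) = (- 1) ^ card S * shuffle_sign n S"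
proof -
  let ?I = "{(i, j). i \<in> S \<and> j \<in> {..<n} - S \<and> j < i}"
  have eq: "{(i, j). i \<in> Suc ` S \<and> j \<in> {..<Suc n} - Suc ` S \<and> j < i} =
    (\<lambda>i. (Suc i, 0)) ` S \<union> map_prod Suc Suc ` ?I"
  proof (intro set_eqI iffI)
    fix z assume z: "z \<in> {(i, j). i \<in> Suc ` S \<and> j \<in> {..<Suc n} - Suc ` S \<and> j < i}"
    then obtain i where i: "fst z = Suc i" "i \<in> S" by auto
    show "z \<in> (\<lambda>i. (Suc i, 0)) ` S \<union> map_prod Suc Suc ` ?I"
    proof (cases "snd z")
      case 0
      then show ?thesis using i by (cases z) auto
    next
      case (Suc j)
      then have "(i, j) \<in> ?I" "z = map_prod Suc Suc (i, j)" using z i by (cases z; auto)+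
      then show ?thesis by blast
    qed
  qed auto
  have fin: "finite S" using assms finite_subset by blast
  have "finite ?I" by (rule finite_subset[of _ "S \<times> {..<n}"]) (use fin in auto)
  then have "card ((\<lambda>i. (Suc i, 0::nat)) ` S \<union> map_prod Suc Suc ` ?I) = card S + card ?I"
    using fin by (subst card_Un_disjoint) (auto simp: card_image inj_on_def)
  then show ?thesis
    unfolding shuffle_sign_def eq by (simp add: power_add)
qed

lemma list_wedge_Nil [simp]: "list_wedge f g [] = f [] * g []"
  by (simp add: list_wedge_def shuffle_sign_def)

text \<open>Contraction with v is an antiderivation. All further identities for
  \<open>list_wedge\<close> come from this recursion, without another look at shuffles.\<close>

lemma list_wedge_Cons:
  "list_wedge f g (v # vs) =
    list_wedge (\<lambda>l. f (v # l)) g vs + list_wedge (grade f) (\<lambda>l. g (v # l)) vs"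
proof -
  \<comment> \<open>Turns the sign \<open>(- 1) ^ card S\<close> into \<open>grade\<close>, since
    \<open>nths vs S\<close> is the argument of f.\<close>
  have len: "length (nths vs S) = card S" if "S \<subseteq> {..<length vs}" for S
    using that by (auto simp: length_nths intro!: arg_cong[where f = card])
  have "\<And>S. {j. Suc j \<in> insert 0 (Suc ` S)} = S" "\<And>S. {j. Suc j \<in> - insert 0 (Suc ` S)} = - S"
    "\<And>S. {j. Suc j \<in> Suc ` S} = S" "\<And>S. {j. Suc j \<in> - Suc ` S} = - S"
    by auto
  then show ?thesis
    unfolding list_wedge_def length_Cons sum_Pow_lessThan_Suc
    by (intro arg_cong2[where f = "(+)"] sum.cong refl)
      (auto simp: shuffle_sign_insert_0 shuffle_sign_image_Suc nths_Cons len scaleR_conv_of_real)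
qed

lemma list_wedge_add_left: "list_wedge (\<lambda>l. f l + f' l) g vs = list_wedge f g vs + list_wedge f' g vs"
  by (simp add: list_wedge_def algebra_simps sum.distrib)

lemma list_wedge_add_right: "list_wedge f (\<lambda>l. g l + g' l) vs = list_wedge f g vs + list_wedge f g' vs"
  by (simp add: list_wedge_def algebra_simps sum.distrib)

lemma list_wedge_minus_left: "list_wedge (\<lambda>l. - f l) g vs = - list_wedge f g vs"
  by (simp add: list_wedge_def sum_negf)

lemma list_wedge_minus_right: "list_wedge f (\<lambda>l. - g l) vs = - list_wedge f g vs"
  by (simp add: list_wedge_def sum_negf)

lemma list_wedge_zero_left: "(\<And>l. f l = 0) \<Longrightarrow> list_wedge f g vs = 0"
  by (simp add: list_wedge_def)

lemma list_wedge_zero_right: "(\<And>l. g l = 0) \<Longrightarrow> list_wedge f g vs = 0"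
  by (simp add: list_wedge_def)

lemma list_wedge_map:
  "list_wedge (\<lambda>l. f (map h l)) (\<lambda>l. g (map h l)) vs = list_wedge f g (map h vs)"
  by (simp add: list_wedge_def nths_map)

lemma grade_list_wedge: "list_wedge (grade f) (grade g) vs = grade (list_wedge f g) vs"
proof (induction vs arbitrary: f g)
  case (Cons v vs)
  \<comment> \<open>Prepending v lengthens the list by one, so grading before and after the
    contraction differ by a sign.\<close>
  have "list_wedge (\<lambda>l. - grade (\<lambda>l. f (v # l)) l) (grade g) vs =
      - ((- 1) ^ length vs * list_wedge (\<lambda>l. f (v # l)) g vs)"
    unfolding list_wedge_minus_left Cons.IH by simp
  moreover have "list_wedge (grade (grade f)) (\<lambda>l. - grade (\<lambda>l. g (v # l)) l) vs =
      - ((- 1) ^ length vs * list_wedge (grade f) (\<lambda>l. g (v # l)) vs)"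
    unfolding list_wedge_minus_right Cons.IH by simp
  ultimately show ?case
    by (simp add: list_wedge_Cons algebra_simps)
qed simp

text \<open>By the antiderivation rule both sides expand into the same three terms, one for each
  factor that receives v; multiplicativity of \<open>grade\<close> matches the third.\<close>

lemma list_wedge_assoc:
  "list_wedge (list_wedge f g) h vs = list_wedge f (list_wedge g h) vs"
proof (induction vs arbitrary: f g h)
  case (Cons v vs)
  have "list_wedge (list_wedge f g) h (v # vs) =
      list_wedge (list_wedge (\<lambda>l. f (v # l)) g) h vs +
      list_wedge (list_wedge (grade f) (\<lambda>l. g (v # l))) h vs +
      list_wedge (list_wedge (grade f) (grade g)) (\<lambda>l. h (v # l)) vs"
    by (simp only: list_wedge_Cons list_wedge_add_left grade_list_wedge[abs_def])
  also have "\<dots> = list_wedge f (list_wedge g h) (v # vs)"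
    by (simp only: list_wedge_Cons list_wedge_add_right Cons.IH add.assoc)
  finally show ?case .
qed simp

text \<open>Both parities are proved together because contracting f with a vector exchanges
  them.\<close>

lemma list_wedge_commute_parity:
  shows "(\<And>l. odd (length l) \<Longrightarrow> f l = 0) \<Longrightarrow> list_wedge f g vs = list_wedge g f vs"
    and "(\<And>l. even (length l) \<Longrightarrow> f l = 0) \<Longrightarrow> list_wedge f g vs = list_wedge (grade g) f vs"
proof (induction vs arbitrary: f g)
  case (Cons v vs)
  {
    case 1
    have "grade f = f"
    proof
      show "grade f l = f l" for l using 1 by (cases "even (length l)") auto
    qed
    then show ?case
      using Cons.IH(1)[of f "\<lambda>l. g (v # l)"] Cons.IH(2)[of "\<lambda>l. f (v # l)" g] 1
      by (simp add: list_wedge_Cons)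
  next
    case 2
    have gf: "grade f = (\<lambda>l. - f l)"
    proof
      show "grade f l = - f l" for l using 2 by (cases "even (length l)") auto
    qed
    have "grade (grade g) = g" by (auto simp: fun_eq_iff)
    moreover have "list_wedge (\<lambda>l. - grade (\<lambda>l. g (v # l)) l) f vs =
        - list_wedge f (\<lambda>l. g (v # l)) vs"
      unfolding list_wedge_minus_left using Cons.IH(2)[of f "\<lambda>l. g (v # l)"] 2 by simp
    ultimately show ?case
      using Cons.IH(1)[of "\<lambda>l. f (v # l)" g] 2
      by (simp add: list_wedge_Cons gf list_wedge_minus_left)
  }
qed (auto simp: mult.commute)

text \<open>Contraction with each u in \<open>us\<close> kills f, and as f is even, g receives u
  without a sign. This is the algebraic core of the projection formula: f will be a form pulled back
  from the base and \<open>us\<close> the vertical vectors.\<close>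

lemma list_wedge_append:
  assumes "\<And>u l. u \<in> set us \<Longrightarrow> f (u # l) = 0" and "\<And>l. odd (length l) \<Longrightarrow> f l = 0"
  shows "list_wedge f g (us @ ws) = list_wedge f (\<lambda>l. g (us @ l)) ws"
  using assms
proof (induction us arbitrary: g)
  case (Cons u us)
  have "grade f = f"
  proof
    show "grade f l = f l" for l using Cons.prems(2) by (cases "even (length l)") auto
  qed
  then show ?case
    using Cons.IH[of "\<lambda>l. g (u # l)"] Cons.prems
    by (simp add: list_wedge_Cons list_wedge_zero_left)
qed simp

text \<open>The summand \<open>w\<^sub>2\<close> is moved past \<open>f\<close>, which costs no sign because its degree is even.\<close>

lemma list_wedge_derivation:
  assumes "\<And>l. list_wedge w\<^sub>1 f l = 0" and "\<And>l. list_wedge w\<^sub>2 g l = 0"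
    and "\<And>l. odd (length l) \<Longrightarrow> w\<^sub>2 l = 0"
  shows "list_wedge (\<lambda>l. w\<^sub>1 l + w\<^sub>2 l) (list_wedge f g) vs = 0"
proof -
  have "list_wedge w\<^sub>2 f = list_wedge f w\<^sub>2"
    using list_wedge_commute_parity(1)[of w\<^sub>2 f] assms(3) by blast
  then have "list_wedge w\<^sub>2 (list_wedge f g) vs = list_wedge f (list_wedge w\<^sub>2 g) vs"
    by (metis list_wedge_assoc)
  also have "\<dots> = 0"
    using assms(2) by (rule list_wedge_zero_right)
  finally show ?thesis
    using assms(1)
    by (simp add: list_wedge_add_left list_wedge_assoc[of w\<^sub>1, symmetric] list_wedge_zero_left)
qed

section \<open>Complex lines\<close>

lemma scaleC_zero_right [simp]: "a *\<^sub>C (0::'l::complex_vector) = 0"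
  using scaleC_add_right[of a 0 0] by simp

lemma scaleC_zero_left [simp]: "0 *\<^sub>C (x::'l::complex_vector) = 0"
  using scaleC_add_left[of 0 0 x] by simp

lemma scaleC_eq_0_iff: "a *\<^sub>C x = 0 \<longleftrightarrow> a = 0 \<or> x = (0::'l::complex_vector)"
proof -
  have "x = 0" if "a *\<^sub>C x = 0" "a \<noteq> 0"
    using that scaleC_scaleC[of "inverse a" a x] by (simp add: scaleC_one)
  then show ?thesis by auto
qed

lemma scaleC_right_cancel:
  assumes "(x::'l::complex_vector) \<noteq> 0"
  shows "a *\<^sub>C x = b *\<^sub>C x \<longleftrightarrow> a = b"
  using scaleC_add_left[of "a - b" b x] assms by (auto simp: scaleC_eq_0_iff)

lemma sum_scaleC_left: "(\<Sum>i\<in>I. f i *\<^sub>C x) = (\<Sum>i\<in>I. f i) *\<^sub>C (x::'l::complex_vector)"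
  by (induction I rule: infinite_finite_induct) (auto simp: scaleC_add_left)

lemma line_coeff_scaleC [simp]: "e \<noteq> 0 \<Longrightarrow> line_coeff e (c *\<^sub>C e) = c"
  unfolding line_coeff_def by (auto simp: scaleC_right_cancel)

lemma line_coeff_self [simp]: "e \<noteq> 0 \<Longrightarrow> line_coeff e e = 1"
  using line_coeff_scaleC[of e 1] by (simp add: scaleC_one)

lemma line_coeff_zero: "e \<noteq> 0 \<Longrightarrow> line_coeff e 0 = 0"
  using line_coeff_scaleC[of e 0] by simp

lemma line_coeff_scaleC_line:
  assumes "complex_line V" "e \<in> V" "e \<noteq> 0" "u \<in> V"
  shows "line_coeff e u *\<^sub>C e = u"
proof -
  obtain b where b: "V = range (\<lambda>c. c *\<^sub>C b)"
    using assms(1) by (auto simp: complex_line_def)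
  then obtain c d where c: "e = c *\<^sub>C b" and d: "u = d *\<^sub>C b" using assms by auto
  then have "c \<noteq> 0" using assms(3) by auto
  then have "u = (d / c) *\<^sub>C e" by (simp add: c d scaleC_scaleC)
  then show ?thesis using assms(3) by simp
qed

lemma line_coeff_mult:
  assumes "complex_line V" "e \<in> V" "e \<noteq> 0" "u \<in> V"
  shows "line_coeff e (c *\<^sub>C u) = c * line_coeff e u"
  using assms(3) line_coeff_scaleC_line[OF assms] line_coeff_scaleC[of e "c * line_coeff e u"]
  by (simp add: scaleC_scaleC[symmetric])

lemma complex_lineI:
  assumes "e \<noteq> 0" "\<And>c. c *\<^sub>C e \<in> V" "\<And>u. u \<in> V \<Longrightarrow> \<exists>c. u = c *\<^sub>C e"
  shows "complex_line V"
  unfolding complex_line_def using assms by blast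

lemma complex_line_nonzero: "complex_line V \<Longrightarrow> \<exists>e\<in>V. e \<noteq> 0"
  unfolding complex_line_def using scaleC_one by (metis rangeI)

lemma complex_line_zero: "complex_line V \<Longrightarrow> 0 \<in> V"
  unfolding complex_line_def using scaleC_zero_left by (metis rangeI)

lemma line_basis:
  assumes "complex_line V"
  shows "line_basis V \<in> V" "line_basis V \<noteq> 0"
  using someI_ex[of "\<lambda>e. e \<in> V \<and> e \<noteq> 0"] complex_line_nonzero[OF assms]
  by (auto simp: line_basis_def)

lemma line_coeff_add:
  assumes "complex_line V" "e \<in> V" "e \<noteq> 0" "u \<in> V" "w \<in> V"
  shows "line_coeff e (u + w) = line_coeff e u + line_coeff e w"
proof -
  have "(line_coeff e u + line_coeff e w) *\<^sub>C e = u + w"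
    using assms by (simp add: scaleC_add_left line_coeff_scaleC_line)
  then show ?thesis using assms(3) line_coeff_scaleC by metis
qed

lemma dual_vector_in_dual_space:
  assumes "complex_line V" "e \<in> V" "e \<noteq> 0"
  shows "dual_vector V e \<in> dual_space V"
  using assms
  by (auto simp: dual_space_def dual_vector_def complex_line_add complex_line_scaleC
      line_coeff_add line_coeff_mult)

lemma dual_vector_self: "e \<in> V \<Longrightarrow> e \<noteq> 0 \<Longrightarrow> dual_vector V e e = 1"
  by (simp add: dual_vector_def)

lemma dual_vector_nonzero: "e \<in> V \<Longrightarrow> e \<noteq> 0 \<Longrightarrow> dual_vector V e \<noteq> 0"
  using dual_vector_self by (metis zero_fun_def zero_neq_one)

lemma dual_space_eq_scaleC_dual_vector:
  assumes "complex_line V" "e \<in> V" "e \<noteq> 0" "f \<in> dual_space V"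
  shows "f = f e *\<^sub>C dual_vector V e"
proof
  fix u
  show "f u = (f e *\<^sub>C dual_vector V e) u"
  proof (cases "u \<in> V")
    case True
    have "f u = f (line_coeff e u *\<^sub>C e)" using assms True by (simp add: line_coeff_scaleC_line)
    also have "\<dots> = line_coeff e u * f e" using assms by (simp add: dual_space_def)
    finally show ?thesis using True by (simp add: scaleC_fun_def dual_vector_def scaleC_complex_def)
  next
    case False
    then show ?thesis using assms by (simp add: dual_space_def scaleC_fun_def dual_vector_def)
  qed
qed

lemma complex_line_dual_space:
  assumes "complex_line V"
  shows "complex_line (dual_space V)"
proof -
  obtain e where e: "e \<in> V" "e \<noteq> 0" using complex_line_nonzero[OF assms] by blast
  show ?thesis
  proof (rule complex_lineI[of "dual_vector V e"])
    show "dual_vector V e \<noteq> 0" using e by (rule dual_vector_nonzero)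
    show "c *\<^sub>C dual_vector V e \<in> dual_space V" for c
      using dual_vector_in_dual_space[OF assms e]
      by (auto simp: dual_space_def scaleC_fun_def scaleC_complex_def algebra_simps)
    show "\<exists>c. f = c *\<^sub>C dual_vector V e" if "f \<in> dual_space V" for f
      using dual_space_eq_scaleC_dual_vector[OF assms e that] by blast
  qed
qed

section \<open>Tensor products of lines and the contraction\<close>

lemma tensor_scaleC:
  assumes "complex_line V" "complex_line W" "u \<in> V" "w \<in> W"
  shows "tensor V W (a *\<^sub>C u) (b *\<^sub>C w) = (a * b) *\<^sub>C tensor V W u w"
  using assms complex_line_scaleC[OF assms(1,3)]
  by (auto simp: fun_eq_iff tensor_def bilinear_on_def scaleC_fun_def scaleC_complex_def)

lemma tensor_in_tensor_space: "u \<in> V \<Longrightarrow> w \<in> W \<Longrightarrow> tensor V W u w \<in> tensor_space V W"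
  by (auto simp: tensor_space_def)

lemma tensor_nonzero:
  assumes V: "complex_line V" and W: "complex_line W"
    and u: "u \<in> V" "u \<noteq> 0" and w: "w \<in> W" "w \<noteq> 0"
  shows "tensor V W u w \<noteq> 0"
proof
  \<comment> \<open>Tensors are detected by evaluation at bilinear functionals; this one takes the
    value 1 at (u, w).\<close>
  let ?B = "\<lambda>x y. line_coeff u x * line_coeff w y"
  assume "tensor V W u w = 0"
  moreover have "bilinear_on V W ?B"
    using assms by (auto simp: bilinear_on_def line_coeff_add line_coeff_mult algebra_simps)
  ultimately have "?B u w = 0" by (metis tensor_def zero_fun_def)
  then show False using u w by simp
qed

lemma complex_line_tensor_space:
  assumes V: "complex_line V" and W: "complex_line W"
  shows "complex_line (tensor_space V W)"
proof -
  obtain e f where e: "e \<in> V" "e \<noteq> 0" and f: "f \<in> W" "f \<noteq> 0"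
    using complex_line_nonzero V W by metis
  show ?thesis
  proof (rule complex_lineI)
    show "tensor V W e f \<noteq> 0" using tensor_nonzero V W e f by blast
    show "c *\<^sub>C tensor V W e f \<in> tensor_space V W" for c
      using tensor_scaleC[OF V W e(1) f(1), of c 1] complex_line_scaleC[OF V e(1)] f(1)
        tensor_in_tensor_space[of "c *\<^sub>C e" V f W]
      by (simp add: scaleC_one)
    show "\<exists>c. t = c *\<^sub>C tensor V W e f" if t_in: "t \<in> tensor_space V W" for t
    proof -
      obtain u w where uw: "u \<in> V" "w \<in> W" "t = tensor V W u w"
        using t_in unfolding tensor_space_def by blast
      then have "t = tensor V W (line_coeff e u *\<^sub>C e) (line_coeff f w *\<^sub>C f)"
        using V W e f by (simp add: line_coeff_scaleC_line)
      then show ?thesis using tensor_scaleC[OF V W e(1) f(1)] by metis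
    qed
  qed
qed

lemma contraction_scaleC: "contraction U W (c *\<^sub>C t) = c *\<^sub>C contraction U W t"
  by (auto simp: contraction_def fun_eq_iff scaleC_fun_def scaleC_complex_def)

lemma contraction_add: "contraction U W (s + t) = contraction U W s + contraction U W t"
  by (auto simp: contraction_def fun_eq_iff)

lemma contraction_zero [simp]: "contraction U W 0 = 0"
  by (auto simp: contraction_def fun_eq_iff)

lemma contraction_sum: "contraction U W (\<Sum>i\<in>I. t i) = (\<Sum>i\<in>I. contraction U W (t i))"
  by (induction I rule: infinite_finite_induct)
    (simp_all only: sum.infinite sum.empty sum.insert contraction_zero contraction_add simp_thms)

text \<open>The frame of the first factor uses the dual of the vector s that occurs in the second.
  As that functional takes the value 1 at s, contraction multiplies the coefficients.\<close>

lemma contraction_frame: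
  fixes U :: "'u::complex_vector set" and V :: "'v::complex_vector set" and W :: "'w::complex_vector set"
  assumes U: "complex_line U" and V: "complex_line V" and W: "complex_line W"
    and e: "e \<in> U" "e \<noteq> 0" and s: "s \<in> V" "s \<noteq> 0" and f: "f \<in> W" "f \<noteq> 0"
    and p: "p \<in> tensor_space U (dual_space V)" and q: "q \<in> tensor_space V W"
  shows "contraction U W (tensor (tensor_space U (dual_space V)) (tensor_space V W) p q) =
    (line_coeff (tensor U (dual_space V) e (dual_vector V s)) p * line_coeff (tensor V W s f) q)
      *\<^sub>C tensor U W e f"
proof -
  let ?D = "dual_space V" and ?s = "dual_vector V s"
  let ?b = "tensor U ?D e ?s" and ?b' = "tensor V W s f"
  have D: "complex_line ?D" and s': "?s \<in> ?D" "?s \<noteq> 0"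
    using complex_line_dual_space[OF V] dual_vector_in_dual_space[OF V s] dual_vector_nonzero[OF s] by auto
  have l: "complex_line (tensor_space U ?D)" "complex_line (tensor_space V W)"
    using U V W D complex_line_tensor_space by blast+
  have b: "?b \<in> tensor_space U ?D" "?b \<noteq> 0" and b': "?b' \<in> tensor_space V W" "?b' \<noteq> 0"
    using tensor_in_tensor_space tensor_nonzero U V W D e s s' f by blast+
  have "tensor (tensor_space U ?D) (tensor_space V W) p q =
    tensor (tensor_space U ?D) (tensor_space V W) (line_coeff ?b p *\<^sub>C ?b) (line_coeff ?b' q *\<^sub>C ?b')"
    using line_coeff_scaleC_line[OF l(1) b p] line_coeff_scaleC_line[OF l(2) b' q] by simp
  also have "\<dots> = (line_coeff ?b p * line_coeff ?b' q) *\<^sub>C tensor (tensor_space U ?D) (tensor_space V W) ?b ?b'"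
    by (rule tensor_scaleC[OF l b(1) b'(1)])
  finally show ?thesis
    using contraction_tensor[OF U e(1) s'(1) s(1) f(1)] dual_vector_self[OF s]
    by (simp add: contraction_scaleC scaleC_one)
qed

section \<open>Charts and tangent vectors\<close>

text \<open>Derivatives are taken in the whole space and depend on a neighbourhood of the point,
  hence S has to be open.\<close>

lemma Ck_on_cong:
  assumes "open S" "\<And>x. x \<in> S \<Longrightarrow> f x = g x" "Ck_on k S f"
  shows "Ck_on k S g"
  using assms(2,3)
proof (induction k arbitrary: f g)
  case 0
  then show ?case using continuous_on_cong by fastforce
next
  case (Suc k)
  have diff: "f differentiable (at x)" if "x \<in> S" for x using Suc.prems that by simp
  have "g differentiable (at x)" if "x \<in> S" for x
  proof -
    obtain D where "(f has_derivative D) (at x)" using Suc.prems(2) \<open>x \<in> S\<close> by (auto simp: differentiable_def)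
    then have "(g has_derivative D) (at x)"
      using has_derivative_transform_within_open assms(1) \<open>x \<in> S\<close> Suc.prems(1) by blast
    then show ?thesis by (auto simp: differentiable_def)
  qed
  moreover have eq: "frechet_derivative f (at x) = frechet_derivative g (at x)" if "x \<in> S" for x
    using frechet_derivative_transform_within_open[OF diff[OF that] assms(1) that Suc.prems(1)] .
  have "Ck_on k S (\<lambda>x. frechet_derivative g (at x) v)" for v
    by (rule Suc.IH[of "\<lambda>x. frechet_derivative f (at x) v"]) (use eq Suc.prems in auto)
  ultimately show ?case by simp
qed

lemma has_derivative_map_prod:
  assumes "(f has_derivative f') (at x)" "(g has_derivative g') (at y)"
  shows "(map_prod f g has_derivative map_prod f' g') (at (x, y))"
proof -
  have "((\<lambda>z. f (fst z)) has_derivative (\<lambda>z. f' (fst z))) (at (x, y))"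
    by (rule has_derivative_compose[OF has_derivative_fst[OF has_derivative_ident]])
      (use assms(1) in simp)
  moreover have "((\<lambda>z. g (snd z)) has_derivative (\<lambda>z. g' (snd z))) (at (x, y))"
    by (rule has_derivative_compose[OF has_derivative_snd[OF has_derivative_ident]])
      (use assms(2) in simp)
  ultimately show ?thesis
    using has_derivative_Pair by (fastforce simp: map_prod_def case_prod_beta')
qed

text \<open>The derivative of a product map in a fixed direction is again a product map, so the
  induction closes once f and g are generalized.\<close>

lemma Ck_on_map_prod:
  assumes "open S" "open T" "Ck_on k S f" "Ck_on k T g"
  shows "Ck_on k (S \<times> T) (map_prod f g)"
  using assms(3,4)
proof (induction k arbitrary: f g)
  case 0
  then show ?case
    by (auto simp: map_prod_def case_prod_beta'
        intro!: continuous_intros continuous_on_compose2[of S f] continuous_on_compose2[of T g])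
next
  case (Suc k)
  have der: "(map_prod f g has_derivative
      map_prod (frechet_derivative f (at (fst z))) (frechet_derivative g (at (snd z)))) (at z)"
    if "z \<in> S \<times> T" for z
    using that Suc.prems by (cases z) (auto intro!: has_derivative_map_prod simp: frechet_derivative_works)
  have "Ck_on k (S \<times> T) (\<lambda>z. frechet_derivative (map_prod f g) (at z) v)" for v
  proof (rule Ck_on_cong[OF open_Times[OF assms(1,2)]])
    show "Ck_on k (S \<times> T) (map_prod (\<lambda>x. frechet_derivative f (at x) (fst v))
        (\<lambda>y. frechet_derivative g (at y) (snd v)))"
      using Suc by simp
    show "map_prod (\<lambda>x. frechet_derivative f (at x) (fst v)) (\<lambda>y. frechet_derivative g (at y) (snd v)) z =
        frechet_derivative (map_prod f g) (at z) v" if "z \<in> S \<times> T" for z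
      using frechet_derivative_at[OF der[OF that]] by (metis fst_map_prod prod.collapse snd_map_prod)
  qed
  moreover have "map_prod f g differentiable (at z)" if "z \<in> S \<times> T" for z
    using der[OF that] by (auto simp: differentiable_def)
  ultimately show ?case by simp
qed

section \<open>Charts and their inverses\<close>

lemma chart_inv_left:
  assumes "smooth_atlas A" "c \<in> A" "x \<in> fst c"
  shows "chart_inv c (snd c x) = x"
  using assms by (auto simp: smooth_atlas_def homeomorphism_def)

lemma chart_inv_right:
  assumes "smooth_atlas A" "c \<in> A" "y \<in> snd c ` fst c"
  shows "snd c (chart_inv c y) = y" "chart_inv c y \<in> fst c"
  using assms by (auto simp: chart_inv_left)

lemma open_chart_image:
  assumes "smooth_atlas A" "c \<in> A" "open W"
  shows "open (snd c ` (fst c \<inter> W))"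
proof -
  have h: "homeomorphism (fst c) (snd c ` fst c) (snd c) (chart_inv c)" and o: "open (snd c ` fst c)"
    using assms by (auto simp: smooth_atlas_def)
  have "openin (top_of_set (snd c ` fst c)) (snd c ` (fst c \<inter> W))"
    by (rule homeomorphism_imp_open_map[OF h]) (use assms in \<open>auto simp: openin_open_Int\<close>)
  then show ?thesis using o openin_open_trans by blast
qed

lemma continuous_on_chart:
  assumes "smooth_atlas A" "c \<in> A"
  shows "continuous_on (fst c) (snd c)" "continuous_on (snd c ` fst c) (chart_inv c)"
  using assms by (auto simp: smooth_atlas_def homeomorphism_def)

lemma smooth_fun_imp_continuous_on:
  assumes "smooth_atlas A" "c \<in> A" "smooth_fun A W f"
  shows "continuous_on (fst c \<inter> W) f"
proof -
  have "Ck_on 0 (snd c ` (fst c \<inter> W)) (f \<circ> chart_inv c)"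
    using assms unfolding smooth_fun_def smooth_on_def by blast
  then have "continuous_on (snd c ` (fst c \<inter> W)) (f \<circ> chart_inv c)" by simp
  moreover have "continuous_on (fst c \<inter> W) (snd c)"
    using continuous_on_chart(1)[OF assms(1,2)] continuous_on_subset by blast
  ultimately have "continuous_on (fst c \<inter> W) ((f \<circ> chart_inv c) \<circ> snd c)"
    by (rule continuous_on_compose[rotated])
  then show ?thesis
    by (rule continuous_on_eq) (simp add: chart_inv_left[OF assms(1,2)])
qed

lemma some_chart:
  assumes "smooth_atlas A"
  shows "some_chart A x \<in> A" "x \<in> fst (some_chart A x)"
proof -
  have "x \<in> (\<Union>c\<in>A. fst c)" using assms by (simp add: smooth_atlas_def)
  then have "\<exists>c. c \<in> A \<and> x \<in> fst c" by blast
  from someI_ex[OF this] show "some_chart A x \<in> A" "x \<in> fst (some_chart A x)"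
    by (auto simp: some_chart_def)
qed

text \<open>Allows replacing \<open>chart_inv d \<circ> snd d\<close> by the identity under a
  derivative, although they agree only on the domain of d.\<close>

lemma has_derivative_chart_cong:
  assumes "smooth_atlas A" "c \<in> A" "x \<in> fst c" "open W" "x \<in> W"
    and "\<And>x'. x' \<in> fst c \<inter> W \<Longrightarrow> f x' = g x'"
    and "((f \<circ> chart_inv c) has_derivative D) (at (snd c x))"
  shows "((g \<circ> chart_inv c) has_derivative D) (at (snd c x))"
  using assms(7)
proof (rule has_derivative_transform_within_open)
  show "open (snd c ` (fst c \<inter> W))" using assms open_chart_image by blast
  show "snd c x \<in> snd c ` (fst c \<inter> W)" using assms by blast
qed (use assms chart_inv_left[OF assms(1,2)] in auto)

section \<open>Transition maps, tangent vectors and differentials\<close>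

abbreviation transition_deriv ::
    "('m, 'a::finite_dim_normed) chart \<Rightarrow> ('m, 'a) chart \<Rightarrow> 'm \<Rightarrow> 'a \<Rightarrow> 'a"
  where "transition_deriv c d x \<equiv> frechet_derivative (snd d \<circ> chart_inv c) (at (snd c x))"

lemma transition_has_derivative:
  assumes "smooth_atlas A" "c \<in> A" "d \<in> A" "x \<in> fst c" "x \<in> fst d"
  shows "((snd d \<circ> chart_inv c) has_derivative transition_deriv c d x) (at (snd c x))"
proof -
  have "Ck_on (Suc 0) (snd c ` (fst c \<inter> fst d)) (snd d \<circ> chart_inv c)"
    using assms unfolding smooth_atlas_def smooth_on_def by blast
  then show ?thesis
    using assms by (simp add: frechet_derivative_works)
qed

lemma transition_deriv_self:
  assumes "smooth_atlas A" "c \<in> A" "x \<in> fst c"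
  shows "transition_deriv c c x a = a"
proof -
  have "((\<lambda>y. y) has_derivative transition_deriv c c x) (at (snd c x))"
    by (rule has_derivative_transform_within_open[OF transition_has_derivative[OF assms(1,2,2,3,3)]
          open_chart_image[OF assms(1,2) open_UNIV]])
      (use assms chart_inv_right[OF assms(1,2)] in auto)
  from has_derivative_unique[OF this has_derivative_ident] show ?thesis by (simp add: fun_eq_iff)
qed

text \<open>The chain rule in the form of a cocycle condition. It makes \<open>coord_vec\<close> a
  tangent vector.\<close>

lemma transition_deriv_comp:
  assumes "smooth_atlas A" "c \<in> A" "d \<in> A" "e \<in> A" "x \<in> fst c" "x \<in> fst d" "x \<in> fst e"
  shows "transition_deriv d e x (transition_deriv c d x a) = transition_deriv c e x a"
proof -
  have d: "(snd d \<circ> chart_inv c) (snd c x) = snd d x"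
    using assms by (simp add: chart_inv_left)
  have "((snd e \<circ> chart_inv d) \<circ> (snd d \<circ> chart_inv c) has_derivative
      transition_deriv d e x \<circ> transition_deriv c d x) (at (snd c x))"
    using assms d by (intro diff_chain_at) (auto intro: transition_has_derivative)
  then have "((snd e \<circ> chart_inv d \<circ> snd d) \<circ> chart_inv c has_derivative
      transition_deriv d e x \<circ> transition_deriv c d x) (at (snd c x))"
    by (simp add: comp_assoc)
  then have "((snd e \<circ> chart_inv c) has_derivative
      transition_deriv d e x \<circ> transition_deriv c d x) (at (snd c x))"
    by (rule has_derivative_chart_cong[OF assms(1,2,5), of "fst d", rotated 3])
      (use assms in \<open>auto simp: chart_inv_left smooth_atlas_def\<close>)
  then have "transition_deriv d e x \<circ> transition_deriv c d x = transition_deriv c e x"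
    by (rule frechet_derivative_at)
  then show ?thesis by (metis comp_apply)
qed

lemma coord_vec_in_tangent_space:
  assumes "smooth_atlas A" "c \<in> A" "x \<in> fst c"
  shows "coord_vec A c x a \<in> tangent_space A x"
proof -
  have "coord_vec A c x a e = transition_deriv d e x (coord_vec A c x a d)"
    if "d \<in> A" "e \<in> A" "x \<in> fst d" "x \<in> fst e" for d e
    using transition_deriv_comp[OF assms(1,2) that(1,2) assms(3) that(3,4), of a] that
    by (simp add: coord_vec_def)
  moreover have "coord_vec A c x a d = 0" if "\<not> (d \<in> A \<and> x \<in> fst d)" for d
    using that unfolding coord_vec_def by (rule if_not_P)
  ultimately show ?thesis
    unfolding tangent_space_def by blast
qed

lemma coord_vec_component:
  assumes "c \<in> A" "x \<in> fst c" "v \<in> tangent_space A x"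
  shows "coord_vec A c x (v c) = v"
proof
  fix d
  have "d \<in> A \<and> x \<in> fst d \<Longrightarrow> v d = transition_deriv c d x (v c)"
    and "\<not> (d \<in> A \<and> x \<in> fst d) \<Longrightarrow> v d = 0"
    using assms unfolding tangent_space_def by blast+
  then show "coord_vec A c x (v c) d = v d"
    unfolding coord_vec_def by presburger
qed

lemma map_coord_vec_component:
  assumes "c \<in> A" "x \<in> fst c" "set vs \<subseteq> tangent_space A x"
  shows "map (coord_vec A c x) (map (\<lambda>v. v c) vs) = vs"
  using assms by (auto intro!: map_idI simp: coord_vec_component subset_iff)

lemma set_map_coord_vec:
  assumes "smooth_atlas A" "c \<in> A" "x \<in> fst c"
  shows "set (map (coord_vec A c x) as) \<subseteq> tangent_space A x"
  using coord_vec_in_tangent_space[OF assms] by auto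

lemma coord_vec_zero:
  assumes "smooth_atlas A" "c \<in> A" "x \<in> fst c"
  shows "coord_vec A c x 0 = 0"
proof
  fix d
  have "transition_deriv c d x 0 = 0" if "d \<in> A" "x \<in> fst d"
    using transition_has_derivative[OF assms(1,2) that(1) assms(3) that(2)]
    by (rule linear_0[OF has_derivative_linear])
  then show "coord_vec A c x 0 d = 0 d"
    by (simp add: coord_vec_def)
qed

text \<open>In the situation of the following lemmas, \<open>\<psi>\<close> is the local representation of \<open>F\<close> in the
  charts \<open>c\<close> and \<open>e\<close>, and \<open>\<Lambda>\<close> is its derivative.\<close>

lemma differential_coord_vec:
  assumes A: "smooth_atlas A" and B: "smooth_atlas B" and c: "c \<in> A" "x \<in> fst c" and e: "e \<in> B"
    and F: "\<And>x'. x' \<in> fst c \<Longrightarrow> F x' \<in> fst e \<and> snd e (F x') = \<psi> (snd c x')"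
    and \<psi>: "(\<psi> has_derivative \<Lambda>) (at (snd c x))"
  shows "differential A B F x (coord_vec A c x a) = coord_vec B e (F x) (\<Lambda> a)"
proof
  fix d
  let ?s = "some_chart A x"
  note s = some_chart[OF A, of x]
  have o: "open (fst c)" using A c by (auto simp: smooth_atlas_def)
  show "differential A B F x (coord_vec A c x a) d = coord_vec B e (F x) (\<Lambda> a) d"
  proof (cases "d \<in> B \<and> F x \<in> fst d")
    case True
    \<comment> \<open>\<open>differential\<close> is computed in \<open>some_chart A x\<close>. The
      chain rule is applied along the path from that chart to c, through \<psi> to e, and on to
      d.\<close>
    have 1: "((snd c \<circ> chart_inv ?s) has_derivative transition_deriv ?s c x) (at (snd ?s x))"
      using A c s by (auto intro: transition_has_derivative)
    have c': "(snd c \<circ> chart_inv ?s) (snd ?s x) = snd c x"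
      using A s by (simp add: chart_inv_left)
    have 2: "((snd d \<circ> chart_inv e) has_derivative transition_deriv e d (F x)) (at (snd e (F x)))"
      using transition_has_derivative[OF B e, of d] True F[OF c(2)] by blast
    have "((snd d \<circ> chart_inv e) \<circ> (\<psi> \<circ> (snd c \<circ> chart_inv ?s)) has_derivative
        transition_deriv e d (F x) \<circ> (\<Lambda> \<circ> transition_deriv ?s c x)) (at (snd ?s x))"
      using 1 2 \<psi> c' F c by (intro diff_chain_at) auto
    then have "((snd d \<circ> chart_inv e \<circ> \<psi> \<circ> snd c) \<circ> chart_inv ?s has_derivative
        transition_deriv e d (F x) \<circ> (\<Lambda> \<circ> transition_deriv ?s c x)) (at (snd ?s x))"
      by (simp add: comp_assoc)
    then have "((snd d \<circ> F) \<circ> chart_inv ?s has_derivative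
        transition_deriv e d (F x) \<circ> (\<Lambda> \<circ> transition_deriv ?s c x)) (at (snd ?s x))"
    proof (rule has_derivative_chart_cong[OF A s o c(2), rotated])
      fix x' assume "x' \<in> fst ?s \<inter> fst c"
      then have "F x' \<in> fst e" "snd e (F x') = \<psi> (snd c x')" using F by auto
      then show "(snd d \<circ> chart_inv e \<circ> \<psi> \<circ> snd c) x' = (snd d \<circ> F) x'"
        using chart_inv_left[OF B e] by (metis comp_apply)
    qed
    from frechet_derivative_at[OF this]
    have "frechet_derivative (snd d \<circ> F \<circ> chart_inv ?s) (at (snd ?s x)) (coord_vec A c x a ?s) =
        transition_deriv e d (F x) (\<Lambda> (transition_deriv ?s c x (coord_vec A c x a ?s)))"
      by (metis comp_apply)
    also have "transition_deriv ?s c x (coord_vec A c x a ?s) = a"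
      using A c s by (simp add: coord_vec_def transition_deriv_comp transition_deriv_self)
    finally show ?thesis
      using True unfolding differential_def Let_def coord_vec_def[of B] by presburger
  next
    case False
    then show ?thesis by (auto simp: differential_def Let_def coord_vec_def)
  qed
qed

text \<open>For the projections used below, \<psi> is linear in product charts, so \<Lambda> equals
  \<psi> and a pullback just drops coordinates.\<close>

lemma pullback_coord_vec:
  assumes "smooth_atlas A" "smooth_atlas B" "c \<in> A" "x \<in> fst c" "e \<in> B"
    and "\<And>x'. x' \<in> fst c \<Longrightarrow> F x' \<in> fst e \<and> snd e (F x') = \<psi> (snd c x')"
    and "(\<psi> has_derivative \<Lambda>) (at (snd c x))"
  shows "pullback A B F \<omega> x (map (coord_vec A c x) as) = \<omega> (F x) (map (coord_vec B e (F x)) (map \<Lambda> as))"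
  using set_map_coord_vec[OF assms(1,3,4), of as] differential_coord_vec[OF assms]
  by (simp add: pullback_def comp_def)

section \<open>Product charts\<close>

abbreviation prod_chart :: "('m, 'a) chart \<Rightarrow> ('n, 'b) chart \<Rightarrow> ('m \<times> 'n, 'a \<times> 'b) chart"
  where "prod_chart c d \<equiv> (fst c \<times> fst d, map_prod (snd c) (snd d))"

lemma prod_chart_in_prod_atlas: "c \<in> A \<Longrightarrow> d \<in> B \<Longrightarrow> prod_chart c d \<in> prod_atlas A B"
  unfolding prod_atlas_def by blast

lemma map_prod_image_Int: "map_prod f g ` (S \<times> T \<inter> S' \<times> T') = f ` (S \<inter> S') \<times> g ` (T \<inter> T')"
  by (auto simp: Times_Int_Times map_prod_image)

lemma chart_inv_prod_chart:
  assumes "smooth_atlas A" "smooth_atlas B" "c \<in> A" "d \<in> B"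
    and "y \<in> snd c ` fst c" "z \<in> snd d ` fst d"
  shows "chart_inv (prod_chart c d) (y, z) = (chart_inv c y, chart_inv d z)"
proof -
  have "inj_on (snd c) (fst c)" "inj_on (snd d) (fst d)"
    using assms chart_inv_left by (metis inj_on_inverseI)+
  then have "inj_on (snd (prod_chart c d)) (fst (prod_chart c d))"
    by (simp add: map_prod_inj_on)
  then have "inv_into (fst (prod_chart c d)) (snd (prod_chart c d))
      (snd (prod_chart c d) (chart_inv c y, chart_inv d z)) = (chart_inv c y, chart_inv d z)"
    by (rule inv_into_f_f) (use chart_inv_right[OF assms(1,3,5)] chart_inv_right[OF assms(2,4,6)] in simp)
  then show ?thesis
    using chart_inv_right[OF assms(1,3,5)] chart_inv_right[OF assms(2,4,6)]
    by (simp add: chart_inv_def[of "prod_chart c d"])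
qed

text \<open>The inverse of a product chart is the product of the inverses only on the image of the
  chart; elsewhere \<open>inv_into\<close> is arbitrary. Continuity and smoothness are therefore
  shown for the product and transferred on the image.\<close>

lemma smooth_atlas_prod:
  assumes A: "smooth_atlas A" and B: "smooth_atlas B"
  shows "smooth_atlas (prod_atlas A B)"
proof -
  have "open (fst e) \<and> open (snd e ` fst e) \<and> homeomorphism (fst e) (snd e ` fst e) (snd e) (chart_inv e)"
    if e_in: "e \<in> prod_atlas A B" for e
  proof -
    obtain c d where e: "e = prod_chart c d" and cd: "c \<in> A" "d \<in> B"
      using e_in unfolding prod_atlas_def by blast
    have o: "open (fst c)" "open (fst d)" "open (snd c ` fst c)" "open (snd d ` fst d)"
      using A B cd by (auto simp: smooth_atlas_def)
    have im: "snd e ` fst e = snd c ` fst c \<times> snd d ` fst d"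
      by (simp add: e map_prod_image)
    have inv: "chart_inv e z = map_prod (chart_inv c) (chart_inv d) z" if "z \<in> snd e ` fst e" for z
      using chart_inv_prod_chart[OF A B cd, of "fst z" "snd z"] that unfolding im by (cases z) (auto simp: e)
    have cont: "continuous_on (S \<times> T) (map_prod f g)" if "continuous_on S f" "continuous_on T g"
      for f :: "'x::topological_space \<Rightarrow> 'y::topological_space"
        and g :: "'z::topological_space \<Rightarrow> 'w::topological_space" and S T
      using that by (auto simp: map_prod_def case_prod_beta'
        intro!: continuous_intros continuous_on_compose2[of S f] continuous_on_compose2[of T g])
    have "continuous_on (snd e ` fst e) (map_prod (chart_inv c) (chart_inv d))"
      unfolding im by (intro cont continuous_on_chart[OF A cd(1)] continuous_on_chart[OF B cd(2)])
    then have "continuous_on (snd e ` fst e) (chart_inv e)"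
      by (rule continuous_on_eq) (simp add: inv)
    moreover have "continuous_on (fst e) (snd e)"
      unfolding e fst_conv snd_conv
      by (intro cont continuous_on_chart[OF A cd(1)] continuous_on_chart[OF B cd(2)])
    moreover have "chart_inv e (snd e x) = x" if "x \<in> fst e" for x
      using that inv[of "snd e x"] chart_inv_left[OF A cd(1)] chart_inv_left[OF B cd(2)]
      by (cases x) (auto simp: e)
    ultimately show ?thesis
      using o unfolding im by (auto simp: e homeomorphism_def im open_Times) (auto simp: image_iff)
  qed
  moreover have "(\<Union>e\<in>prod_atlas A B. fst e) = UNIV"
  proof -
    have "(x, y) \<in> (\<Union>e\<in>prod_atlas A B. fst e)" for x y
      using some_chart[OF A, of x] some_chart[OF B, of y]
      by (intro UN_I[OF prod_chart_in_prod_atlas]) auto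
    then show ?thesis by auto
  qed
  moreover have "smooth_on (snd e ` (fst e \<inter> fst e')) (snd e' \<circ> chart_inv e)"
    if e_in: "e \<in> prod_atlas A B" "e' \<in> prod_atlas A B" for e e'
  proof -
    obtain c d c' d' where e: "e = prod_chart c d" "e' = prod_chart c' d'"
      and cd: "c \<in> A" "d \<in> B" "c' \<in> A" "d' \<in> B"
      using e_in unfolding prod_atlas_def by blast
    let ?S = "snd c ` (fst c \<inter> fst c')" and ?T = "snd d ` (fst d \<inter> fst d')"
    have o: "open ?S" "open ?T"
      using A B cd by (auto intro!: open_chart_image simp: smooth_atlas_def)
    have "Ck_on k (?S \<times> ?T) (snd e' \<circ> chart_inv e)" for k
    proof (rule Ck_on_cong[OF open_Times[OF o]])
      show "Ck_on k (?S \<times> ?T) (map_prod (snd c' \<circ> chart_inv c) (snd d' \<circ> chart_inv d))"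
        using A B cd o by (intro Ck_on_map_prod) (auto simp: smooth_atlas_def smooth_on_def)
      show "map_prod (snd c' \<circ> chart_inv c) (snd d' \<circ> chart_inv d) z = (snd e' \<circ> chart_inv e) z"
        if "z \<in> ?S \<times> ?T" for z
        using that chart_inv_prod_chart[OF A B cd(1,2), of "fst z" "snd z"] by (cases z) (auto simp: e)
    qed
    then show ?thesis
      unfolding smooth_on_def by (simp add: e map_prod_image_Int)
  qed
  ultimately show ?thesis
    unfolding smooth_atlas_def by blast
qed

section \<open>Integration over compact manifolds\<close>

lemma model_basis:
  "distinct (model_basis :: 'a::finite_dim_normed list)"
  "independent (set (model_basis :: 'a list))"
  "span (set (model_basis :: 'a list)) = UNIV"
proof -
  obtain B :: "'a set" where B: "finite B" "span B = UNIV" using finite_dim by blast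
  obtain B' where B': "B' \<subseteq> B" "independent B'" "B \<subseteq> span B'"
    using maximal_independent_subset by blast
  then have "span B' = UNIV" using B(2) span_mono[OF B'(3)] by (simp add: span_span top.extremum_unique)
  moreover obtain bs where "set bs = B'" "distinct bs"
    using finite_distinct_list finite_subset[OF B'(1) B(1)] by blast
  ultimately have "\<exists>bs::'a list. distinct bs \<and> independent (set bs) \<and> span (set bs) = UNIV"
    using B'(2) by blast
  from someI_ex[OF this]
  show "distinct (model_basis :: 'a list)" "independent (set (model_basis :: 'a list))"
    "span (set (model_basis :: 'a list)) = UNIV"
    by (auto simp: model_basis_def)
qed

text \<open>Linear independence indexed by positions, as in the parametrization behind
  \<open>model_measure\<close>.\<close>

lemma model_basis_independent:
  assumes "(\<Sum>i<length (model_basis :: 'a::finite_dim_normed list). x i *\<^sub>R (model_basis :: 'a list) ! i) = 0"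
    and "i < length (model_basis :: 'a list)"
  shows "x i = 0"
proof -
  let ?bs = "model_basis :: 'a list"
  have inj: "inj_on ((!) ?bs) {..<length ?bs}"
    by (rule inj_on_nth) (auto simp: model_basis)
  define u where "u v = x (inv_into {..<length ?bs} ((!) ?bs) v)" for v
  have u: "u (?bs ! i) = x i" if "i < length ?bs" for i
    using that inj by (simp add: u_def)
  have "set ?bs = (!) ?bs ` {..<length ?bs}"
    by (auto simp: set_conv_nth)
  then have "(\<Sum>v\<in>set ?bs. u v *\<^sub>R v) = (\<Sum>i<length ?bs. u (?bs ! i) *\<^sub>R ?bs ! i)"
    by (simp add: sum.reindex[OF inj])
  also have "\<dots> = 0" using assms(1) u by simp
  finally have "u (?bs ! i) = 0"
    by (rule independentD[OF model_basis(2) finite_set subset_refl]) (use assms(2) in simp)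
  then show ?thesis using u assms(2) by simp
qed

text \<open>The norm attains a minimum on the compact unit sphere of the sum norm; independence
  makes this minimum positive, and scaling extends the bound. For r = 0 the sphere is empty, so that
  case is separate.\<close>

lemma norm_linear_combination_lower_bound:
  fixes b :: "nat \<Rightarrow> 'a::real_normed_vector"
  assumes indep: "\<And>x i. (\<Sum>i<r. x i *\<^sub>R b i) = 0 \<Longrightarrow> i < r \<Longrightarrow> x i = 0"
  shows "\<exists>m>0. \<forall>x. m * (\<Sum>i<r. \<bar>x i\<bar>) \<le> norm (\<Sum>i<r. x i *\<^sub>R b i)"
proof (cases "r = 0")
  case True
  then show ?thesis by (auto intro: exI[of _ 1])
next
  case False
  \<comment> \<open>Coefficient vectors are functions on all naturals. Pinning the coordinates from
    r on to 0 gives a product of compact sets, compact by Tychonoff's theorem.\<close>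
  let ?box = "PiE UNIV (\<lambda>i. if i < r then {-1..1} else {0}) :: (nat \<Rightarrow> real) set"
  let ?K = "?box \<inter> {x. (\<Sum>i<r. \<bar>x i\<bar>) = 1}"
  have "compactin (product_topology (\<lambda>_::nat. euclidean::real topology) UNIV) ?box"
    unfolding compactin_PiE by auto
  then have "compact ?box" by (simp add: euclidean_product_topology)
  moreover have "closed {x::nat \<Rightarrow> real. (\<Sum>i<r. \<bar>x i\<bar>) = 1}"
    by (intro closed_Collect_eq continuous_intros continuous_on_product_coordinates)
  ultimately have "compact ?K" by (rule compact_Int_closed)
  \<comment> \<open>The first unit vector lies on the sphere, as r is positive.\<close>
  moreover have "(\<lambda>i. if i = 0 then 1 else 0) \<in> ?K"
    using False by (auto simp: if_distrib[of abs] cong: if_cong)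
  then have "?K \<noteq> {}" by blast
  moreover have "continuous_on ?K (\<lambda>x. norm (\<Sum>i<r. x i *\<^sub>R b i))"
    by (intro continuous_intros continuous_on_subset[OF continuous_on_product_coordinates]) auto
  ultimately obtain x0 where x0: "x0 \<in> ?K"
    and min: "\<And>x. x \<in> ?K \<Longrightarrow> norm (\<Sum>i<r. x0 i *\<^sub>R b i) \<le> norm (\<Sum>i<r. x i *\<^sub>R b i)"
    using continuous_attains_inf[of ?K "\<lambda>x. norm (\<Sum>i<r. x i *\<^sub>R b i)"] by blast
  let ?m = "norm (\<Sum>i<r. x0 i *\<^sub>R b i)"
  have "(\<Sum>i<r. x0 i *\<^sub>R b i) \<noteq> 0"
  proof
    assume "(\<Sum>i<r. x0 i *\<^sub>R b i) = 0"
    then have "(\<Sum>i<r. \<bar>x0 i\<bar>) = 0" using indep[of x0] by simp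
    then show False using x0 by simp
  qed
  then have m: "?m > 0" by simp
  have bound: "?m * (\<Sum>i<r. \<bar>x i\<bar>) \<le> norm (\<Sum>i<r. x i *\<^sub>R b i)" for x
  proof (cases "(\<Sum>i<r. \<bar>x i\<bar>) = 0")
    case False
    define t where "t = (\<Sum>i<r. \<bar>x i\<bar>)"
    have "t \<ge> 0" unfolding t_def by (intro sum_nonneg) simp
    then have t: "t > 0" using False unfolding t_def[symmetric] by linarith
    \<comment> \<open>The coefficients rescaled to the sphere, with 0 from r on so as to lie in the
      box.\<close>
    let ?y = "\<lambda>i. if i < r then x i / t else 0"
    have y: "x i / t \<in> {-1..1}" if "i < r" for i
    proof -
      have "\<bar>x i\<bar> \<le> t"
        unfolding t_def using \<open>i < r\<close> member_le_sum[of i "{..<r}" "\<lambda>i. \<bar>x i\<bar>"] by simp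
      then have "x i \<le> t" "- t \<le> x i" by linarith+
      then show ?thesis using t by (simp only: atLeastAtMost_iff pos_le_divide_eq pos_divide_le_eq) simp
    qed
    have "?y \<in> ?box"
    proof (rule PiE_I)
      show "?y i \<in> (if i < r then {-1..1} else {0})" for i
        using y[of i] by (cases "i < r") simp_all
    qed simp
    moreover have "(\<Sum>i<r. \<bar>?y i\<bar>) = (\<Sum>i<r. \<bar>x i\<bar> / t)"
      using t by (intro sum.cong) (simp_all add: abs_divide)
    then have "(\<Sum>i<r. \<bar>?y i\<bar>) = 1"
      using t unfolding sum_divide_distrib[symmetric] t_def[symmetric] by simp
    ultimately have "?m \<le> norm (\<Sum>i<r. ?y i *\<^sub>R b i)" by (intro min IntI CollectI)
    also have "(\<Sum>i<r. ?y i *\<^sub>R b i) = (1 / t) *\<^sub>R (\<Sum>i<r. x i *\<^sub>R b i)"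
      by (simp add: scaleR_sum_right)
    finally have "?m \<le> norm (\<Sum>i<r. x i *\<^sub>R b i) / t" using t by simp
    then show ?thesis using t unfolding t_def[symmetric] by (simp add: pos_le_divide_eq)
  qed simp
  show ?thesis
    by (intro exI[of _ ?m] conjI allI m bound)
qed

lemma sets_model_measure [simp]: "sets model_measure = sets borel"
  by (simp add: model_measure_def)

lemma space_model_measure [simp]: "space model_measure = UNIV"
  by (simp add: model_measure_def)

lemma measurable_model_measure: "measurable model_measure N = measurable borel N"
  by (rule measurable_cong_sets) simp_all

text \<open>By the lower bound, the coordinates of the points of a bounded set lie in a cube of
  half-width R / m, which has finite measure.\<close>

lemma emeasure_model_measure_compact:
  fixes K :: "'a::finite_dim_normed set"
  assumes "compact K"
  shows "emeasure model_measure K < \<infinity>"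
proof -
  let ?bs = "model_basis :: 'a list"
  let ?r = "length ?bs"
  let ?\<Phi> = "\<lambda>x. \<Sum>i<?r. x i *\<^sub>R ?bs ! i"
  let ?P = "PiM {..<?r} (\<lambda>_. lborel :: real measure)"
  interpret product_sigma_finite "\<lambda>_. lborel :: real measure" by standard
  obtain m where m: "m > 0" "\<And>x. m * (\<Sum>i<?r. \<bar>x i\<bar>) \<le> norm (?\<Phi> x)"
    using norm_linear_combination_lower_bound[where r = ?r and b = "(!) ?bs"] model_basis_independent by blast
  obtain R where R: "\<And>y. y \<in> K \<Longrightarrow> norm y \<le> R"
    using compact_imp_bounded[OF assms] by (auto simp: bounded_iff)
  let ?box = "PiE {..<?r} (\<lambda>_. {- (R / m)..R / m})"
  have meas: "?\<Phi> \<in> measurable ?P borel"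
  proof (intro borel_measurable_sum borel_measurable_scaleR borel_measurable_const)
    show "(\<lambda>x. x i) \<in> borel_measurable ?P" if "i \<in> {..<?r}" for i
      using measurable_component_singleton[OF that, of "\<lambda>_. lborel :: real measure"] by simp
  qed
  have K: "K \<in> sets borel" using assms by (rule borel_compact)
  have sub: "?\<Phi> -` K \<inter> space ?P \<subseteq> ?box"
  proof
    fix x assume x: "x \<in> ?\<Phi> -` K \<inter> space ?P"
    have "\<bar>x i\<bar> \<le> R / m" if "i < ?r" for i
    proof -
      have "\<bar>x i\<bar> \<le> (\<Sum>i<?r. \<bar>x i\<bar>)"
        using that member_le_sum[of i "{..<?r}" "\<lambda>i. \<bar>x i\<bar>"] by simp
      then have "m * \<bar>x i\<bar> \<le> m * (\<Sum>i<?r. \<bar>x i\<bar>)" using m(1) by simp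
      also have "\<dots> \<le> norm (?\<Phi> x)" by (rule m(2))
      also have "\<dots> \<le> R" using R x by simp
      finally show ?thesis using m(1) by (simp add: field_simps)
    qed
    moreover have "x \<in> extensional {..<?r}" using x by (simp add: space_PiM PiE_iff)
    ultimately show "x \<in> ?box" by (simp add: PiE_iff abs_le_iff minus_le_iff)
  qed
  have "emeasure model_measure K = emeasure ?P (?\<Phi> -` K \<inter> space ?P)"
    unfolding model_measure_def by (rule emeasure_distr[OF meas K])
  also have "\<dots> \<le> emeasure ?P ?box"
    by (rule emeasure_mono[OF sub]) (auto intro!: sets_PiM_I_finite)
  also have "\<dots> = (\<Prod>i<?r. emeasure lborel {- (R / m)..R / m})"
    by (rule emeasure_PiM) auto
  also have "\<dots> < \<infinity>"
    by (simp add: emeasure_lborel_Icc_eq ennreal_power)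
  finally show ?thesis .
qed

section \<open>Integrability and linear relations between integrals\<close>

text \<open>The support of \<rho> is compact since the manifold is. Its image in the chart has
  finite measure, and the integrand is bounded there and 0 elsewhere. As w may vanish, its sign
  enters as a bounded Borel function.\<close>

lemma chart_integrand_integrable:
  fixes A :: "('m::topological_space, 'a::finite_dim_normed) chart set" and g :: "'m \<Rightarrow> complex"
  assumes A: "smooth_atlas A" and cpt: "compact (UNIV :: 'm set)" and c: "c \<in> A"
    and \<rho>: "smooth_fun A UNIV \<rho>" "closure {x. \<rho> x \<noteq> 0} \<subseteq> fst c"
    and w: "continuous_on (fst c) w" and g: "continuous_on (fst c) g"
  shows "integrable model_measure (\<lambda>y. indicator (snd c ` fst c) y *\<^sub>R
    ((\<rho> (chart_inv c y) * sgn (w (chart_inv c y))) *\<^sub>R g (chart_inv c y)))"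
proof -
  let ?O = "snd c ` fst c" and ?inv = "chart_inv c"
  let ?K = "snd c ` closure {x. \<rho> x \<noteq> 0}"
  let ?h = "\<lambda>y. \<rho> (?inv y) *\<^sub>R g (?inv y)"
  note chart = continuous_on_chart[OF A c] and inv = chart_inv_right[OF A c]
  have O: "open ?O" using A c by (auto simp: smooth_atlas_def)
  have inv_sub: "?inv ` ?O \<subseteq> fst c" using inv by auto
  have \<rho>': "continuous_on (fst c) \<rho>" using smooth_fun_imp_continuous_on[OF A c \<rho>(1)] by simp
  have h: "continuous_on ?O ?h"
    by (intro continuous_intros continuous_on_compose2[OF \<rho>' chart(2) inv_sub]
        continuous_on_compose2[OF g chart(2) inv_sub])
  have "compact (UNIV \<inter> closure {x. \<rho> x \<noteq> 0})"
    using cpt by (rule compact_Int_closed) simp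
  then have K: "compact ?K"
    using compact_continuous_image[OF continuous_on_subset[OF chart(1) \<rho>(2)]] by simp
  have KO: "?K \<subseteq> ?O" using \<rho>(2) by blast
  have "bounded (?h ` ?K)"
    by (rule compact_imp_bounded[OF compact_continuous_image[OF continuous_on_subset[OF h KO] K]])
  then obtain C where C: "\<And>y. y \<in> ?K \<Longrightarrow> norm (?h y) \<le> C"
    unfolding bounded_iff by auto
  \<comment> \<open>With an indicator in each factor, w and the rest become continuous functions on
    an open set extended by 0; \<open>chart_inv\<close> is uncontrolled outside.\<close>
  have "(\<lambda>y. sgn (indicator ?O y *\<^sub>R w (?inv y)) *\<^sub>R (indicator ?O y *\<^sub>R ?h y)) \<in> borel_measurable borel"
    using O by (intro borel_measurable_scaleR measurable_compose[OF _ borel_measurable_sgn]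
        borel_measurable_continuous_on_indicator h continuous_on_compose2[OF w chart(2) inv_sub]) auto
  also have "(\<lambda>y. sgn (indicator ?O y *\<^sub>R w (?inv y)) *\<^sub>R (indicator ?O y *\<^sub>R ?h y)) =
      (\<lambda>y. indicator ?O y *\<^sub>R ((\<rho> (?inv y) * sgn (w (?inv y))) *\<^sub>R g (?inv y)))" (is "_ = ?f")
    by (auto simp: fun_eq_iff indicator_def)
  finally have meas: "?f \<in> borel_measurable model_measure"
    by (simp add: measurable_model_measure)
  have null: "?f y = 0" if "y \<notin> ?K" for y
  proof (cases "y \<in> ?O")
    case True
    then have "?inv y \<notin> closure {x. \<rho> x \<noteq> 0}"
      using that imageI[of "?inv y" "closure {x. \<rho> x \<noteq> 0}" "snd c"] by (auto simp only: inv(1)[OF True])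
    then have "\<rho> (?inv y) = 0" using closure_subset[of "{x. \<rho> x \<noteq> 0}"] by blast
    then show ?thesis by simp
  qed simp
  have bound: "norm (?f y) \<le> C" if "y \<in> ?K" for y
  proof -
    have "\<bar>indicator ?O y\<bar> * (\<bar>\<rho> (?inv y)\<bar> * \<bar>sgn (w (?inv y))\<bar>) \<le> 1 * (\<bar>\<rho> (?inv y)\<bar> * 1)"
      by (intro mult_mono) (auto simp: indicator_def sgn_real_def)
    then have "norm (?f y) \<le> norm (?h y)"
      by (simp add: abs_mult mult_right_mono mult.assoc[symmetric])
    then show ?thesis using C[OF that] by simp
  qed
  show ?thesis
    by (rule integrableI_bounded_set[where A = ?K and B = C])
      (use K meas emeasure_model_measure_compact[OF K] bound null in \<open>auto intro: borel_compact\<close>)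
qed

text \<open>Generalized over the arguments because the recursion evaluates the lower power on
  sublists.\<close>

lemma wedge_power_coord_continuous:
  assumes A: "smooth_atlas A" and \<omega>: "\<omega> \<in> real_forms A" and c: "c \<in> A"
  shows "continuous_on (fst c) (\<lambda>x. wedge_power \<omega> k x (map (coord_vec A c x) as))"
proof (induction k arbitrary: as)
  case (Suc k)
  have "continuous_on (fst c) (\<lambda>x. \<omega> x (map (coord_vec A c x) as))" for as
    using smooth_fun_imp_continuous_on[OF A c, of "fst c"] \<omega> c by (auto simp: real_forms_def)
  then show ?case
    unfolding wedge_power.simps wedge_def nths_map length_map
    by (intro continuous_intros Suc.IH)
qed simp

text \<open>Each chart integral is additive on integrable integrands, and continuity on coordinate
  frames supplies integrability. The relation is tested only on the frames that
  \<open>chart_integral\<close> evaluates. Without a partition of unity all integrals take the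
  default value 0.\<close>

lemma symplectic_integral_linear_relation:
  fixes A :: "('m::topological_space, 'a::finite_dim_normed) chart set"
    and \<tau> :: "'i \<Rightarrow> ('m, 'a, complex) form"
  assumes A: "smooth_atlas A" and cpt: "compact (UNIV :: 'm set)" and \<omega>: "\<omega> \<in> real_forms A"
    and cont: "\<And>j c. j \<in> J \<Longrightarrow> c \<in> A \<Longrightarrow>
      continuous_on (fst c) (\<lambda>x. \<tau> j x (map (coord_vec A c x) model_basis))"
    and rel: "\<And>c x. c \<in> A \<Longrightarrow> x \<in> fst c \<Longrightarrow>
      (\<Sum>j\<in>J. r j *\<^sub>R \<tau> j x (map (coord_vec A c x) model_basis)) = 0"
  shows "(\<Sum>j\<in>J. r j *\<^sub>R symplectic_integral A \<omega> (\<tau> j)) = 0"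
proof (cases "\<exists>P. partition_of_unity A P")
  case True
  let ?P = "SOME P. partition_of_unity A P"
  have P: "partition_of_unity A ?P" using someI_ex[OF True] .
  have "(\<Sum>j\<in>J. r j *\<^sub>R chart_integral A \<omega> c \<rho> (\<tau> j)) = 0" if c\<rho>: "(c, \<rho>) \<in> ?P" for c \<rho>
  proof -
    have c: "c \<in> A" and \<rho>: "smooth_fun A UNIV \<rho>" "closure {x. \<rho> x \<noteq> 0} \<subseteq> fst c"
      using P c\<rho> by (auto simp: partition_of_unity_def)
    let ?bs = "\<lambda>x. map (coord_vec A c x) model_basis"
    let ?w = "\<lambda>x. wedge_power \<omega> (length (?bs x) div 2) x (?bs x)"
    let ?f = "\<lambda>j y. indicator (snd c ` fst c) y *\<^sub>R
      ((\<rho> (chart_inv c y) * sgn (?w (chart_inv c y))) *\<^sub>R \<tau> j (chart_inv c y) (?bs (chart_inv c y)))"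
    have int: "integrable model_measure (?f j)" if "j \<in> J" for j
      using wedge_power_coord_continuous[OF A \<omega> c] cont[OF that c]
      by (intro chart_integrand_integrable[OF A cpt c \<rho>]) auto
    have "(\<Sum>j\<in>J. r j *\<^sub>R chart_integral A \<omega> c \<rho> (\<tau> j)) = (\<Sum>j\<in>J. LINT y|model_measure. r j *\<^sub>R ?f j y)"
      using int by (intro sum.cong refl)
        (simp only: chart_integral_def set_lebesgue_integral_def Let_def integral_scaleR_right)
    also have "\<dots> = (LINT y|model_measure. (\<Sum>j\<in>J. r j *\<^sub>R ?f j y))"
      using int by (intro Bochner_Integration.integral_sum[symmetric] integrable_scaleR_right)
    also have "(\<lambda>y. \<Sum>j\<in>J. r j *\<^sub>R ?f j y) = (\<lambda>_. 0)"
    proof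
      fix y
      let ?s = "\<rho> (chart_inv c y) * sgn (?w (chart_inv c y))"
      have "(\<Sum>j\<in>J. r j *\<^sub>R ?f j y) = indicator (snd c ` fst c) y *\<^sub>R ?s *\<^sub>R
          (\<Sum>j\<in>J. r j *\<^sub>R \<tau> j (chart_inv c y) (?bs (chart_inv c y)))"
        by (simp add: scaleR_sum_right mult_ac)
      then show "(\<Sum>j\<in>J. r j *\<^sub>R ?f j y) = 0"
        using rel[OF c] chart_inv_right(2)[OF A c, of y] by (simp add: indicator_def)
    qed
    finally show ?thesis by simp
  qed
  then have "(\<Sum>(c, \<rho>)\<in>?P. \<Sum>j\<in>J. r j *\<^sub>R chart_integral A \<omega> c \<rho> (\<tau> j)) = 0"
    by (intro sum.neutral) auto
  then show ?thesis
    using True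
    by (simp add: symplectic_integral_def scaleR_sum_right case_prod_unfold sum.swap[of _ J])
qed (simp add: symplectic_integral_def)

section \<open>Composition in coordinates\<close>

lemma pullback_fst_coord_vec:
  assumes "smooth_atlas A" "smooth_atlas B" "c \<in> A" "d \<in> B" "x \<in> fst c" "y \<in> fst d"
  shows "pullback (prod_atlas A B) A fst \<omega> (x, y) (map (coord_vec (prod_atlas A B) (prod_chart c d) (x, y)) as) =
    \<omega> x (map (coord_vec A c x) (map fst as))"
proof -
  have "(fst has_derivative fst) (at z)" for z :: "'b \<times> 'd"
    by (intro has_derivative_fst has_derivative_ident)
  then show ?thesis
    using pullback_coord_vec[of "prod_atlas A B" A "prod_chart c d" "(x, y)" c fst fst fst \<omega> as] assms
    by (auto simp: smooth_atlas_prod prod_chart_in_prod_atlas)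
qed

lemma pullback_snd_coord_vec:
  assumes "smooth_atlas A" "smooth_atlas B" "c \<in> A" "d \<in> B" "x \<in> fst c" "y \<in> fst d"
  shows "pullback (prod_atlas A B) B snd \<omega> (x, y) (map (coord_vec (prod_atlas A B) (prod_chart c d) (x, y)) as) =
    \<omega> y (map (coord_vec B d y) (map snd as))"
proof -
  have "(snd has_derivative snd) (at z)" for z :: "'b \<times> 'd"
    by (intro has_derivative_snd has_derivative_ident)
  then show ?thesis
    using pullback_coord_vec[of "prod_atlas A B" B "prod_chart c d" "(x, y)" d snd snd snd \<omega> as] assms
    by (auto simp: smooth_atlas_prod prod_chart_in_prod_atlas)
qed

lemma pullback_12_coord_vec:
  assumes "smooth_atlas A" "smooth_atlas B" "smooth_atlas C" "c \<in> A" "d \<in> B" "e \<in> C"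
    and "x \<in> fst c" "y \<in> fst d" "z \<in> fst e"
  shows "pullback (prod_atlas A (prod_atlas B C)) (prod_atlas A B) (\<lambda>(x, y, z). (x, y)) \<omega> (x, y, z)
      (map (coord_vec (prod_atlas A (prod_atlas B C)) (prod_chart c (prod_chart d e)) (x, y, z)) as) =
    \<omega> (x, y) (map (coord_vec (prod_atlas A B) (prod_chart c d) (x, y)) (map (\<lambda>(a, b, c). (a, b)) as))"
proof -
  have "((\<lambda>(a, b, c). (a, b)) has_derivative (\<lambda>(a, b, c). (a, b))) (at u)"
    for u :: "'b \<times> 'd \<times> 'f"
    unfolding case_prod_beta' by (intro derivative_eq_intros | simp)+
  then show ?thesis
    using pullback_coord_vec[of "prod_atlas A (prod_atlas B C)" "prod_atlas A B"
        "prod_chart c (prod_chart d e)" "(x, y, z)" "prod_chart c d" "\<lambda>(x, y, z). (x, y)"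
        "\<lambda>(x, y, z). (x, y)" "\<lambda>(x, y, z). (x, y)" \<omega> as] assms
      prod_chart_in_prod_atlas[OF assms(4) prod_chart_in_prod_atlas[OF assms(5,6)]]
    by (auto simp: smooth_atlas_prod prod_chart_in_prod_atlas)
qed

text \<open>Vertical vectors have zero components along M and P. This is why forms pulled back from
  the base vanish on them.\<close>

lemma differential_fibre_inclusion:
  assumes "smooth_atlas A" "smooth_atlas B" "smooth_atlas C" "c \<in> A" "d \<in> B" "e \<in> C"
    and "x \<in> fst c" "y \<in> fst d" "z \<in> fst e"
  shows "differential B (prod_atlas A (prod_atlas B C)) (\<lambda>y. (x, y, z)) y (coord_vec B d y b) =
    coord_vec (prod_atlas A (prod_atlas B C)) (prod_chart c (prod_chart d e)) (x, y, z) (0, b, 0)"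
proof -
  have "((\<lambda>b. (snd c x, b, snd e z)) has_derivative (\<lambda>b. (0, b, 0))) (at u)" for u
    by (intro derivative_eq_intros | simp)+
  then show ?thesis
    using differential_coord_vec[of B "prod_atlas A (prod_atlas B C)" d y "prod_chart c (prod_chart d e)"
        "\<lambda>y. (x, y, z)" "\<lambda>b. (snd c x, b, snd e z)" "\<lambda>b. (0, b, 0)" b] assms
      prod_chart_in_prod_atlas[OF assms(4) prod_chart_in_prod_atlas[OF assms(5,6)]]
    by (auto simp: smooth_atlas_prod prod_chart_in_prod_atlas)
qed

text \<open>Horizontal lifts have zero component along N and keep the others, so a form pulled back
  from the base sees them unchanged.\<close>

lemma differential_horizontal_inclusion:
  assumes "smooth_atlas A" "smooth_atlas B" "smooth_atlas C" "c \<in> A" "d \<in> B" "e \<in> C"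
    and "x \<in> fst c" "y \<in> fst d" "z \<in> fst e"
  shows "differential (prod_atlas A C) (prod_atlas A (prod_atlas B C)) (\<lambda>(x, z). (x, y, z)) (x, z)
      (coord_vec (prod_atlas A C) (prod_chart c e) (x, z) h) =
    coord_vec (prod_atlas A (prod_atlas B C)) (prod_chart c (prod_chart d e)) (x, y, z) (fst h, 0, snd h)"
proof -
  have "((\<lambda>(a, c). (a, snd d y, c)) has_derivative (\<lambda>(a, c). (a, 0, c))) (at u)" for u :: "'b \<times> 'f"
    unfolding case_prod_beta' by (intro derivative_eq_intros | simp)+
  then show ?thesis
    using differential_coord_vec[of "prod_atlas A C" "prod_atlas A (prod_atlas B C)" "prod_chart c e" "(x, z)"
        "prod_chart c (prod_chart d e)" "\<lambda>(x, z). (x, y, z)" "\<lambda>(a, c). (a, snd d y, c)"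
        "\<lambda>(a, c). (a, 0, c)" h] assms
      prod_chart_in_prod_atlas[OF assms(4) prod_chart_in_prod_atlas[OF assms(5,6)]]
    by (auto simp: smooth_atlas_prod prod_chart_in_prod_atlas case_prod_beta')
qed

lemma alternating_on_zero_Cons:
  assumes "alternating_on T f" "0 \<in> T" "set vs \<subseteq> T"
  shows "f (0 # vs) = 0"
proof -
  have "f ([] @ (0 *\<^sub>R 0) # vs) = 0 *\<^sub>R f ([] @ 0 # vs)"
    using assms unfolding alternating_on_def by (metis Un_insert_right empty_set insert_subset sup_bot.left_neutral sup_bot_right)
  then show ?thesis by simp
qed

lemma symplectic_integral_eq_0:
  fixes A :: "('m::topological_space, 'a::finite_dim_normed) chart set"
  assumes "smooth_atlas A" "compact (UNIV :: 'm set)" "\<omega> \<in> real_forms A"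
    and "\<And>c x. c \<in> A \<Longrightarrow> x \<in> fst c \<Longrightarrow> \<tau> x (map (coord_vec A c x) model_basis) = 0"
  shows "symplectic_integral A \<omega> \<tau> = 0"
proof -
  have "(\<Sum>j\<in>{()}. 1 *\<^sub>R symplectic_integral A \<omega> \<tau>) = 0"
  proof (rule symplectic_integral_linear_relation[OF assms(1-3)])
    show "continuous_on (fst c) (\<lambda>x. \<tau> x (map (coord_vec A c x) model_basis))" if "c \<in> A" for c
      by (rule continuous_on_eq[OF continuous_on_const[of _ 0]]) (use assms(4) that in simp)
  qed (use assms(4) in simp)
  then show ?thesis by simp
qed

section \<open>From line-valued forms to complex coefficients\<close>

text \<open>All values of \<xi> at x lie in one line, so a basis vector e can be factored out of the
  shuffle sum.\<close>

lemma scalar_wedge_line: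
  assumes "complex_line V" "e \<in> V" "e \<noteq> 0" "\<And>vs. \<xi> x vs \<in> V"
  shows "scalar_wedge \<omega> \<xi> x (map \<phi> as) =
    list_wedge (\<lambda>l. complex_of_real (\<omega> x (map \<phi> l))) (\<lambda>l. line_coeff e (\<xi> x (map \<phi> l))) as *\<^sub>C e"
proof -
  have "\<xi> x vs = line_coeff e (\<xi> x vs) *\<^sub>C e" for vs
    using line_coeff_scaleC_line[OF assms(1-3) assms(4)] by simp
  then have "scalar_wedge \<omega> \<xi> x (map \<phi> as) = (\<Sum>S\<in>Pow {..<length as}. shuffle_sign (length as) S *\<^sub>R
      \<omega> x (map \<phi> (nths as S)) *\<^sub>R line_coeff e (\<xi> x (map \<phi> (nths as (- S)))) *\<^sub>C e)"
    unfolding wedge_def by (simp add: nths_map)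
  then show ?thesis
    by (simp add: list_wedge_def scaleR_scaleC scaleC_scaleC sum_scaleC_left scaleC_complex_def mult.assoc)
qed


lemma prequantum_systemD:
  fixes X :: "('m::{t2_space, second_countable_topology}, 'a::finite_dim_normed, 'l::complex_vector) prequantum"
  assumes "prequantum_system X"
  shows "smooth_atlas (atlas X)" "compact (UNIV :: 'm set)"
    "sympl X \<in> real_forms (atlas X)" "homogeneous 2 (sympl X)"
    "is_line_bundle (atlas X) (lbundle X)"
  using assms by (auto simp: prequantum_system_def symplectic_form_def)

lemma bundle_forms_in_fib: "\<xi> \<in> bundle_forms A E \<Longrightarrow> \<xi> x vs \<in> fib E x"
  by (simp add: bundle_forms_def)

lemma Gamma_formsD:
  assumes "\<xi> \<in> Gamma_forms X"
  shows "\<xi> x vs \<in> fib (lbundle X) x" "lefschetz X \<xi> = 0"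
  using assms by (simp_all add: Gamma_forms_def bundle_forms_def)

lemma line_bundle_fib: "is_line_bundle A E \<Longrightarrow> complex_line (fib E x)"
  by (simp add: is_line_bundle_def)

lemma line_bundle_frame:
  assumes "is_line_bundle A E" "(U, s) \<in> frames E" "x \<in> U"
  shows "s x \<in> fib E x" "s x \<noteq> 0"
  using assms unfolding is_line_bundle_def by blast+

lemma line_bundle_frame_exists:
  assumes "is_line_bundle A E"
  shows "\<exists>U s. (U, s) \<in> frames E \<and> x \<in> U"
proof -
  have "x \<in> (\<Union>(U, s)\<in>frames E. U)" using assms by (simp add: is_line_bundle_def)
  then show ?thesis by blast
qed

text \<open>The argument t is a vector in the fibre at x rather than a section. It may be any
  nonzero vector in pointwise identities and the value of a frame where continuity matters.\<close>

definition local_coeff ::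
    "('m, 'a::finite_dim_normed) chart set \<Rightarrow> ('m, 'a) chart \<Rightarrow> 'l::complex_vector \<Rightarrow>
     ('m, 'a, 'l) form \<Rightarrow> 'm \<Rightarrow> 'a list \<Rightarrow> complex"
  where "local_coeff A c t \<xi> x as = line_coeff t (\<xi> x (map (coord_vec A c x) as))"

lemma local_coeff_continuous_on:
  assumes "smooth_atlas A" "\<xi> \<in> bundle_forms A E" "c \<in> A" "(U, s) \<in> frames E"
  shows "continuous_on (fst c \<inter> U) (\<lambda>x. local_coeff A c (s x) \<xi> x as)"
proof -
  have "smooth_section A E (fst c) (\<lambda>x. \<xi> x (map (coord_vec A c x) as))"
    using assms(2,3) by (simp add: bundle_forms_def)
  then have "smooth_fun A (U \<inter> fst c) (\<lambda>x. line_coeff (s x) (\<xi> x (map (coord_vec A c x) as)))"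
    using assms(4) unfolding smooth_section_def by blast
  then have "continuous_on (fst c \<inter> (U \<inter> fst c)) (\<lambda>x. local_coeff A c (s x) \<xi> x as)"
    unfolding local_coeff_def by (rule smooth_fun_imp_continuous_on[OF assms(1,3)])
  then show ?thesis by (rule continuous_on_subset) blast
qed

text \<open>The kernel condition is pointwise, and a multiple of e vanishes only if its coefficient
  does.\<close>

lemma lefschetz_kernel_local_coeff:
  assumes "lefschetz X \<xi> = 0" "complex_line V" "e \<in> V" "e \<noteq> 0" "\<And>vs. \<xi> x vs \<in> V"
  shows "list_wedge (\<lambda>l. complex_of_real (sympl X x (map (coord_vec A c x) l))) (local_coeff A c e \<xi> x) as = 0"
proof -
  have "scalar_wedge (sympl X) \<xi> x (map (coord_vec A c x) as) = 0"
    using assms(1) by (simp add: lefschetz_def)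
  then show ?thesis
    using scalar_wedge_line[OF assms(2-4), of \<xi> x "sympl X" "coord_vec A c x" as] assms(4,5)
    by (simp add: scaleC_eq_0_iff local_coeff_def[abs_def])
qed

section \<open>Fibrewise computation for three prequantum systems\<close>

locale three_prequantum =
  fixes M :: "('m::{t2_space, second_countable_topology}, 'a::finite_dim_normed, 'l::complex_vector) prequantum"
    and N :: "('n::{t2_space, second_countable_topology}, 'b::finite_dim_normed, 'k::complex_vector) prequantum"
    and P :: "('p::{t2_space, second_countable_topology}, 'c::finite_dim_normed, 'j::complex_vector) prequantum"
  assumes M: "prequantum_system M" and N: "prequantum_system N" and P: "prequantum_system P"
begin

abbreviation "A \<equiv> atlas M"
abbreviation "B \<equiv> atlas N"
abbreviation "C \<equiv> atlas P"
abbreviation "MN \<equiv> prod_system M (dual_system N)"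
abbreviation "NP \<equiv> prod_system N (dual_system P)"
abbreviation "MP \<equiv> prod_system M (dual_system P)"

lemmas A = prequantum_systemD(1)[OF M] and B = prequantum_systemD(1)[OF N]
  and C = prequantum_systemD(1)[OF P]

lemma fib_MN: "fib (lbundle MN) (x, y) = tensor_space (fib (lbundle M) x) (dual_space (fib (lbundle N) y))"
  and fib_NP: "fib (lbundle NP) (y, z) = tensor_space (fib (lbundle N) y) (dual_space (fib (lbundle P) z))"
  and fib_MP: "fib (lbundle MP) (x, z) = tensor_space (fib (lbundle M) x) (dual_space (fib (lbundle P) z))"
  and fib_dual_P: "fib (lbundle (dual_system P)) z = dual_space (fib (lbundle P) z)"
  by (simp_all add: prod_system_def Let_def box_bundle_def dual_system_def dual_bundle_def)

lemma atlas_MN: "atlas MN = prod_atlas A B" and atlas_NP: "atlas NP = prod_atlas B C"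
  by (simp_all add: prod_system_def Let_def dual_system_def)

lemma lines:
  "complex_line (fib (lbundle M) x)" "complex_line (fib (lbundle N) y)"
  "complex_line (dual_space (fib (lbundle N) y))" "complex_line (dual_space (fib (lbundle P) z))"
  using prequantum_systemD(5)[OF M] prequantum_systemD(5)[OF N] prequantum_systemD(5)[OF P]
  by (simp_all add: complex_line_dual_space line_bundle_fib)

lemma complex_line_fib:
  "complex_line (fib (lbundle MN) (x, y))" "complex_line (fib (lbundle NP) (y, z))"
  "complex_line (fib (lbundle MP) (x, z))"
  by (simp_all add: fib_MN fib_NP fib_MP complex_line_tensor_space lines)

abbreviation "frame_MN x y e s \<equiv> tensor (fib (lbundle M) x) (dual_space (fib (lbundle N) y)) e (dual_vector (fib (lbundle N) y) s)"
abbreviation "frame_NP y z s f \<equiv> tensor (fib (lbundle N) y) (dual_space (fib (lbundle P) z)) s f"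

text \<open>The contracted product of the two pullbacks on M \<times> N \<times> P, before fibre
  integration.\<close>

definition pairing :: "('m \<times> 'n, 'a \<times> 'b, ('l, 'k \<Rightarrow> complex) tensor) form \<Rightarrow>
    ('n \<times> 'p, 'b \<times> 'c, ('k, 'j \<Rightarrow> complex) tensor) form \<Rightarrow>
    ('m \<times> 'n \<times> 'p, 'a \<times> 'b \<times> 'c, ('l, 'j \<Rightarrow> complex) tensor) form"
  where "pairing \<xi> \<eta> = (\<lambda>(m, n, p) vs.
    contraction (fib (lbundle M) m) (dual_space (fib (lbundle P) p))
      (wedge (\<lambda>(m, n, p). tensor (fib (lbundle MN) (m, n)) (fib (lbundle NP) (n, p)))
        (pullback (prod_atlas A (prod_atlas B C)) (prod_atlas A B) (\<lambda>(m, n, p). (m, n)) \<xi>)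
        (pullback (prod_atlas A (prod_atlas B C)) (prod_atlas B C) (\<lambda>(m, n, p). (n, p)) \<eta>)
        (m, n, p) vs))"

text \<open>The integrand over N, made complex-valued by a basis of the fibre over (m, p), which is
  the same line for all n.\<close>

definition fibre_form :: "('m \<times> 'n, 'a \<times> 'b, ('l, 'k \<Rightarrow> complex) tensor) form \<Rightarrow>
    ('n \<times> 'p, 'b \<times> 'c, ('k, 'j \<Rightarrow> complex) tensor) form \<Rightarrow> 'm \<Rightarrow> 'p \<Rightarrow>
    ('m \<times> 'p, 'a \<times> 'c) tangent list \<Rightarrow> ('n, 'b, complex) form"
  where "fibre_form \<xi> \<eta> m p ws = (\<lambda>n us.
    line_coeff (line_basis (fib (lbundle MP) (m, p))) (pairing \<xi> \<eta> (m, n, p)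
      (map (differential B (prod_atlas A (prod_atlas B C)) (\<lambda>n. (m, n, p)) n) us @
       map (differential (prod_atlas A C) (prod_atlas A (prod_atlas B C)) (\<lambda>(m, p). (m, n, p)) (m, p)) ws)))"

lemma compose_forms_eq:
  "compose_forms M N P \<xi> \<eta> (m, p) ws = (if set ws \<subseteq> tangent_space (prod_atlas A C) (m, p)
    then symplectic_integral B (sympl N) (fibre_form \<xi> \<eta> m p ws) *\<^sub>C line_basis (fib (lbundle MP) (m, p))
    else 0)"
  by (simp add: compose_forms_def fibre_integral_def line_integral_def Let_def fibre_form_def pairing_def
      atlas_MN atlas_NP fib_dual_P)

text \<open>The frames are adapted to the contraction: s^* in the first factor is dual to s in the
  second, so the value is a product of coefficients times e \<otimes> f.\<close>

lemma pairing_coord_vec: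
  assumes c: "c \<in> A" "x \<in> fst c" and d: "d \<in> B" "y \<in> fst d" and g: "g \<in> C" "z \<in> fst g"
    and e: "e \<in> fib (lbundle M) x" "e \<noteq> 0" and s: "s \<in> fib (lbundle N) y" "s \<noteq> 0"
    and f: "f \<in> dual_space (fib (lbundle P) z)" "f \<noteq> 0"
    and \<xi>: "\<And>vs. \<xi> (x, y) vs \<in> fib (lbundle MN) (x, y)" and \<eta>: "\<And>vs. \<eta> (y, z) vs \<in> fib (lbundle NP) (y, z)"
  shows "pairing \<xi> \<eta> (x, y, z)
      (map (coord_vec (prod_atlas A (prod_atlas B C)) (prod_chart c (prod_chart d g)) (x, y, z)) hs) =
    list_wedge
      (\<lambda>l. local_coeff (prod_atlas A B) (prod_chart c d) (frame_MN x y e s) \<xi> (x, y) (map (\<lambda>(a, b, c). (a, b)) l))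
      (\<lambda>l. local_coeff (prod_atlas B C) (prod_chart d g) (frame_NP y z s f) \<eta> (y, z) (map snd l)) hs
    *\<^sub>C tensor (fib (lbundle M) x) (dual_space (fib (lbundle P) z)) e f"
proof -
  \<comment> \<open>The projection j forgets the first factor of M \<times> (N \<times> P).\<close>
  have snd_eq: "(\<lambda>(m, n, p). (n, p)) = snd" by auto
  have BC: "smooth_atlas (prod_atlas B C)" using B C by (rule smooth_atlas_prod)
  have dg: "prod_chart d g \<in> prod_atlas B C" using d g by (simp add: prod_chart_in_prod_atlas)
  have p1: "pullback (prod_atlas A (prod_atlas B C)) (prod_atlas A B) (\<lambda>(m, n, p). (m, n)) \<xi> (x, y, z)
      (map (coord_vec (prod_atlas A (prod_atlas B C)) (prod_chart c (prod_chart d g)) (x, y, z)) l) =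
    \<xi> (x, y) (map (coord_vec (prod_atlas A B) (prod_chart c d) (x, y)) (map (\<lambda>(a, b, c). (a, b)) l))" for l
    by (rule pullback_12_coord_vec[OF A B C c(1) d(1) g(1) c(2) d(2) g(2)])
  have p2: "pullback (prod_atlas A (prod_atlas B C)) (prod_atlas B C) (\<lambda>(m, n, p). (n, p)) \<eta> (x, y, z)
      (map (coord_vec (prod_atlas A (prod_atlas B C)) (prod_chart c (prod_chart d g)) (x, y, z)) l) =
    \<eta> (y, z) (map (coord_vec (prod_atlas B C) (prod_chart d g) (y, z)) (map snd l))" for l
    unfolding snd_eq using pullback_snd_coord_vec[OF A BC c(1) dg c(2), of "(y, z)"] d(2) g(2) by simp
  show ?thesis
    unfolding pairing_def case_prod_conv wedge_def contraction_sum length_map nths_map p1 p2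
    unfolding scaleR_scaleC contraction_scaleC fib_MN fib_NP
      contraction_frame[OF lines(1,2,4) e s f \<xi>[unfolded fib_MN] \<eta>[unfolded fib_NP]]
    by (simp add: list_wedge_def local_coeff_def scaleC_scaleC sum_scaleC_left scaleR_scaleC
        scaleC_complex_def nths_map)
qed

text \<open>The last factor compares e \<otimes> f with the basis picked by
  \<open>line_basis\<close>; it does not involve y or s and stays constant along the fibre once e
  and f are fixed.\<close>

lemma fibre_form_coord_vec:
  assumes c: "c \<in> A" "x \<in> fst c" and d: "d \<in> B" "y \<in> fst d" and g: "g \<in> C" "z \<in> fst g"
    and e: "e \<in> fib (lbundle M) x" "e \<noteq> 0" and s: "s \<in> fib (lbundle N) y" "s \<noteq> 0"
    and f: "f \<in> dual_space (fib (lbundle P) z)" "f \<noteq> 0"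
    and \<xi>: "\<And>vs. \<xi> (x, y) vs \<in> fib (lbundle MN) (x, y)" and \<eta>: "\<And>vs. \<eta> (y, z) vs \<in> fib (lbundle NP) (y, z)"
  shows "fibre_form \<xi> \<eta> x z (map (coord_vec (prod_atlas A C) (prod_chart c g) (x, z)) hs) y
      (map (coord_vec B d y) bs) =
    list_wedge
      (\<lambda>l. local_coeff (prod_atlas A B) (prod_chart c d) (frame_MN x y e s) \<xi> (x, y) (map (\<lambda>(a, b, c). (a, b)) l))
      (\<lambda>l. local_coeff (prod_atlas B C) (prod_chart d g) (frame_NP y z s f) \<eta> (y, z) (map snd l))
      (map (\<lambda>b. (0, b, 0)) bs @ map (\<lambda>h. (fst h, 0, snd h)) hs)
    * line_coeff (line_basis (fib (lbundle MP) (x, z)))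
        (tensor (fib (lbundle M) x) (dual_space (fib (lbundle P) z)) e f)"
proof -
  let ?v = "coord_vec (prod_atlas A (prod_atlas B C)) (prod_chart c (prod_chart d g)) (x, y, z)"
  have 1: "map (differential B (prod_atlas A (prod_atlas B C)) (\<lambda>y. (x, y, z)) y) (map (coord_vec B d y) bs) =
      map ?v (map (\<lambda>b. (0, b, 0)) bs)"
    using differential_fibre_inclusion[OF A B C c(1) d(1) g(1) c(2) d(2) g(2)] by simp
  have 2: "map (differential (prod_atlas A C) (prod_atlas A (prod_atlas B C)) (\<lambda>(x, z). (x, y, z)) (x, z))
        (map (coord_vec (prod_atlas A C) (prod_chart c g) (x, z)) hs) =
      map ?v (map (\<lambda>h. (fst h, 0, snd h)) hs)"
    using differential_horizontal_inclusion[OF A B C c(1) d(1) g(1) c(2) d(2) g(2)] by simp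
  have t: "tensor (fib (lbundle M) x) (dual_space (fib (lbundle P) z)) e f \<in> fib (lbundle MP) (x, z)"
    unfolding fib_MP by (rule tensor_in_tensor_space[OF e(1) f(1)])
  show ?thesis
    unfolding fibre_form_def 1 2 map_append[symmetric] pairing_coord_vec[where \<xi> = \<xi> and \<eta> = \<eta>, OF c d g e s f \<xi> \<eta>]
    by (rule line_coeff_mult[OF complex_line_fib(3) line_basis[OF complex_line_fib(3)] t])
qed


lemma sympl_coord_vec:
  assumes "c \<in> A" "x \<in> fst c" "d \<in> B" "y \<in> fst d" "g \<in> C" "z \<in> fst g"
  shows sympl_MN_coord_vec: "sympl MN (x, y) (map (coord_vec (prod_atlas A B) (prod_chart c d) (x, y)) as) =
      sympl M x (map (coord_vec A c x) (map fst as)) - sympl N y (map (coord_vec B d y) (map snd as))"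
    and sympl_NP_coord_vec: "sympl NP (y, z) (map (coord_vec (prod_atlas B C) (prod_chart d g) (y, z)) bs) =
      sympl N y (map (coord_vec B d y) (map fst bs)) - sympl P z (map (coord_vec C g z) (map snd bs))"
    and sympl_MP_coord_vec: "sympl MP (x, z) (map (coord_vec (prod_atlas A C) (prod_chart c g) (x, z)) cs) =
      sympl M x (map (coord_vec A c x) (map fst cs)) - sympl P z (map (coord_vec C g z) (map snd cs))"
  using assms A B C
  by (simp_all only: prod_system_def dual_system_def Let_def prequantum.simps plus_fun_apply
      pullback_fst_coord_vec pullback_snd_coord_vec diff_conv_add_uminus)

text \<open>Frames over M and P are evaluated once, at x and z, but the frame over N has to follow y
  and exists only locally. Continuity is shown on each open piece of the chart domain that carries a
  frame, and the pieces cover the domain.\<close>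

lemma fibre_form_continuous_on:
  assumes \<xi>: "\<xi> \<in> bundle_forms (prod_atlas A B) (lbundle MN)" and \<eta>: "\<eta> \<in> bundle_forms (prod_atlas B C) (lbundle NP)"
    and c: "c \<in> A" "x \<in> fst c" and d: "d \<in> B" and g: "g \<in> C" "z \<in> fst g"
  shows "continuous_on (fst d) (\<lambda>y. fibre_form \<xi> \<eta> x z
    (map (coord_vec (prod_atlas A C) (prod_chart c g) (x, z)) hs) y (map (coord_vec B d y) bs))"
    (is "continuous_on _ ?F")
proof -
  note lb = prequantum_systemD(5)[OF M] prequantum_systemD(5)[OF N] prequantum_systemD(5)[OF P]
  obtain U t where t: "(U, t) \<in> frames (lbundle M)" "x \<in> U" using line_bundle_frame_exists[OF lb(1)] by blast
  obtain V r where r: "(V, r) \<in> frames (lbundle P)" "z \<in> V" using line_bundle_frame_exists[OF lb(3)] by blast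
  have f: "dual_vector (fib (lbundle P) z) (r z) \<in> dual_space (fib (lbundle P) z)"
    "dual_vector (fib (lbundle P) z) (r z) \<noteq> 0"
    using line_bundle_frame[OF lb(3) r]
    by (simp_all add: dual_vector_in_dual_space dual_vector_nonzero line_bundle_fib[OF lb(3)])
  have \<xi>_fib: "\<xi> u vs \<in> fib (lbundle MN) u" and \<eta>_fib: "\<eta> v ws \<in> fib (lbundle NP) v" for u vs v ws
    by (rule bundle_forms_in_fib[OF \<xi>] bundle_forms_in_fib[OF \<eta>])+
  have cont: "continuous_on (fst d \<inter> W) ?F" and op: "open (fst d \<inter> W)" if s: "(W, s) \<in> frames (lbundle N)" for W s
  proof -
    \<comment> \<open>One frame s of \<open>L_N\<close> serves both factors: through its dual here,
      and as it stands in the frame of \<open>NP\<close>.\<close>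
    have "(U \<times> W, \<lambda>(x, y). frame_MN x y (t x) (s y)) \<in> frames (lbundle MN)"
      using t(1) s by (force simp: prod_system_def Let_def box_bundle_def dual_system_def dual_bundle_def)
    note lc = local_coeff_continuous_on[OF smooth_atlas_prod[OF A B] \<xi> prod_chart_in_prod_atlas[OF c(1) d] this]
    have a: "continuous_on (fst d \<inter> W) (\<lambda>y. local_coeff (prod_atlas A B) (prod_chart c d)
        (frame_MN x y (t x) (s y)) \<xi> (x, y) as)" for as
      by (rule continuous_on_compose2[OF lc[of as], of "fst d \<inter> W" "\<lambda>y. (x, y)", unfolded case_prod_conv])
        (use c t in \<open>auto intro: continuous_on_Pair continuous_on_const continuous_on_id\<close>)
    have "(W \<times> V, \<lambda>(y, z). frame_NP y z (s y) (dual_vector (fib (lbundle P) z) (r z))) \<in> frames (lbundle NP)"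
      using r(1) s by (force simp: prod_system_def Let_def box_bundle_def dual_system_def dual_bundle_def)
    note lc = local_coeff_continuous_on[OF smooth_atlas_prod[OF B C] \<eta> prod_chart_in_prod_atlas[OF d g(1)] this]
    have b: "continuous_on (fst d \<inter> W) (\<lambda>y. local_coeff (prod_atlas B C) (prod_chart d g)
        (frame_NP y z (s y) (dual_vector (fib (lbundle P) z) (r z))) \<eta> (y, z) as)" for as
      by (rule continuous_on_compose2[OF lc[of as], of "fst d \<inter> W" "\<lambda>y. (y, z)", unfolded case_prod_conv])
        (use g r in \<open>auto intro: continuous_on_Pair continuous_on_const continuous_on_id\<close>)
    show "continuous_on (fst d \<inter> W) ?F"
    proof (rule continuous_on_eq)
      let ?G = "\<lambda>y. list_wedge
        (\<lambda>l. local_coeff (prod_atlas A B) (prod_chart c d) (frame_MN x y (t x) (s y)) \<xi> (x, y) (map (\<lambda>(a, b, c). (a, b)) l))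
        (\<lambda>l. local_coeff (prod_atlas B C) (prod_chart d g) (frame_NP y z (s y) (dual_vector (fib (lbundle P) z) (r z)))
          \<eta> (y, z) (map snd l))
        (map (\<lambda>b. (0, b, 0)) bs @ map (\<lambda>h. (fst h, 0, snd h)) hs)
        * line_coeff (line_basis (fib (lbundle MP) (x, z)))
            (tensor (fib (lbundle M) x) (dual_space (fib (lbundle P) z)) (t x) (dual_vector (fib (lbundle P) z) (r z)))"
      show "continuous_on (fst d \<inter> W) ?G"
        unfolding list_wedge_def by (intro continuous_intros a b)
      show "?G y = ?F y" if y: "y \<in> fst d \<inter> W" for y
        using y line_bundle_frame[OF lb(1) t] line_bundle_frame[OF lb(2) s]
        by (intro fibre_form_coord_vec[symmetric] c d g f \<xi>_fib \<eta>_fib) auto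
    qed
    show "open (fst d \<inter> W)"
      using s lb(2) d B unfolding is_line_bundle_def smooth_atlas_def by blast
  qed
  have "continuous_on (\<Union>(W, s)\<in>frames (lbundle N). fst d \<inter> W) ?F"
  proof (rule continuous_on_open_UN)
    fix Ws assume "Ws \<in> frames (lbundle N)"
    then show "open (case Ws of (W, s) \<Rightarrow> fst d \<inter> W)" "continuous_on (case Ws of (W, s) \<Rightarrow> fst d \<inter> W) ?F"
      using cont[of "fst Ws" "snd Ws"] op[of "fst Ws" "snd Ws"] by (simp_all add: case_prod_unfold)
  qed
  moreover have "(\<Union>(W, s)\<in>frames (lbundle N). fst d \<inter> W) = fst d"
    using line_bundle_frame_exists[OF lb(2)] by fast
  ultimately show ?thesis by simp
qed

text \<open>The coefficients do not depend on y, so this can be integrated over N. Up to a constant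
  the sum is the full product with \<open>\<omega>_M - \<omega>_P\<close> on M \<times> N \<times>
  P, evaluated at vertical and then horizontal vectors: shuffles that feed a vertical vector to the
  two-form contribute nothing.\<close>

lemma pointwise_relation:
  assumes \<xi>: "\<xi> \<in> Gamma_forms MN" and \<eta>: "\<eta> \<in> Gamma_forms NP"
    and c: "c \<in> A" "x \<in> fst c" and d: "d \<in> B" "y \<in> fst d" and g: "g \<in> C" "z \<in> fst g"
  defines "v \<equiv> coord_vec (prod_atlas A C) (prod_chart c g) (x, z)"
  shows "(\<Sum>S\<in>Pow {..<length hs}. (shuffle_sign (length hs) S * sympl MP (x, z) (map v (nths hs S))) *\<^sub>R
    fibre_form \<xi> \<eta> x z (map v (nths hs (- S))) y (map (coord_vec B d y) bs)) = 0"
proof -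
  note lb = prequantum_systemD(5)[OF M] prequantum_systemD(5)[OF N] prequantum_systemD(5)[OF P]
  have \<xi>_fib: "\<xi> u vs \<in> fib (lbundle MN) u" and \<eta>_fib: "\<eta> v ws \<in> fib (lbundle NP) v" for u vs v ws
    by (rule Gamma_formsD(1)[OF \<xi>] Gamma_formsD(1)[OF \<eta>])+
  obtain e s f where e: "e \<in> fib (lbundle M) x" "e \<noteq> 0" and s: "s \<in> fib (lbundle N) y" "s \<noteq> 0"
    and f: "f \<in> dual_space (fib (lbundle P) z)" "f \<noteq> 0"
    using complex_line_nonzero lines by metis
  let ?a = "\<lambda>l. local_coeff (prod_atlas A B) (prod_chart c d) (frame_MN x y e s) \<xi> (x, y) (map (\<lambda>(a, b, c). (a, b)) l)"
  let ?b = "\<lambda>l. local_coeff (prod_atlas B C) (prod_chart d g) (frame_NP y z s f) \<eta> (y, z) (map snd l)"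
  let ?\<kappa> = "line_coeff (line_basis (fib (lbundle MP) (x, z)))
        (tensor (fib (lbundle M) x) (dual_space (fib (lbundle P) z)) e f)"
  let ?\<omega>M = "\<lambda>l :: ('a \<times> 'b \<times> 'c) list. complex_of_real (sympl M x (map (coord_vec A c x) (map fst l)))"
  let ?\<omega>N = "\<lambda>l :: ('a \<times> 'b \<times> 'c) list. complex_of_real (sympl N y (map (coord_vec B d y) (map (\<lambda>h. fst (snd h)) l)))"
  let ?\<omega>P = "\<lambda>l :: ('a \<times> 'b \<times> 'c) list. complex_of_real (sympl P z (map (coord_vec C g z) (map (\<lambda>h. snd (snd h)) l)))"
  let ?w = "\<lambda>l. ?\<omega>M l - ?\<omega>P l"
  let ?us = "map (\<lambda>b. (0 :: 'a, b, 0 :: 'c)) bs" and ?h = "\<lambda>h :: 'a \<times> 'c. (fst h, 0 :: 'b, snd h)"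
  have frames: "frame_MN x y e s \<in> fib (lbundle MN) (x, y)" "frame_MN x y e s \<noteq> 0"
    "frame_NP y z s f \<in> fib (lbundle NP) (y, z)" "frame_NP y z s f \<noteq> 0"
    using e s f dual_vector_in_dual_space[OF lines(2) s] dual_vector_nonzero[OF s]
    by (simp_all add: fib_MN fib_NP tensor_in_tensor_space tensor_nonzero lines)
  have "list_wedge (\<lambda>l. complex_of_real (sympl MN (x, y) (map (coord_vec (prod_atlas A B) (prod_chart c d) (x, y)) l)))
      (local_coeff (prod_atlas A B) (prod_chart c d) (frame_MN x y e s) \<xi> (x, y)) (map (\<lambda>(a, b, c). (a, b)) l) = 0" for l
    by (rule lefschetz_kernel_local_coeff[where \<xi> = \<xi>,
          OF Gamma_formsD(2)[OF \<xi>] complex_line_fib(1) frames(1,2) \<xi>_fib])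
  \<comment> \<open>\<open>list_wedge_map\<close> moves the kernel condition from coordinates on M
    \<times> N to triple coordinates, where all three two-forms can be compared.\<close>
  then have ker_\<xi>: "list_wedge (\<lambda>l. ?\<omega>M l - ?\<omega>N l) ?a l = 0" for l
    unfolding list_wedge_map[symmetric] sympl_MN_coord_vec[OF c d g] by (simp add: comp_def case_prod_unfold)
  have "list_wedge (\<lambda>l. complex_of_real (sympl NP (y, z) (map (coord_vec (prod_atlas B C) (prod_chart d g) (y, z)) l)))
      (local_coeff (prod_atlas B C) (prod_chart d g) (frame_NP y z s f) \<eta> (y, z)) (map snd l) = 0" for l
    by (rule lefschetz_kernel_local_coeff[where \<xi> = \<eta>,
          OF Gamma_formsD(2)[OF \<eta>] complex_line_fib(2) frames(3,4) \<eta>_fib])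
  then have ker_\<eta>: "list_wedge (\<lambda>l. ?\<omega>N l - ?\<omega>P l) ?b l = 0" for l
    unfolding list_wedge_map[symmetric] sympl_NP_coord_vec[OF c d g] by (simp add: comp_def)
  have odd: "\<omega> u vs = 0" if "homogeneous 2 \<omega>" "odd (length vs)" for u vs and \<omega> :: "('q, 'r, real) form"
    using that unfolding homogeneous_def by (metis even_numeral)
  have odd_M: "?\<omega>M l = 0" and odd_N: "?\<omega>N l = 0" and odd_P: "?\<omega>P l = 0" if "odd (length l)" for l
    using that odd[OF prequantum_systemD(4)[OF M]] odd[OF prequantum_systemD(4)[OF N]]
      odd[OF prequantum_systemD(4)[OF P]] by simp_all
  have relation: "list_wedge ?w (list_wedge ?a ?b) l = 0" for l
  proof -
    \<comment> \<open>The N-terms cancel in the sum of the two kernel forms.\<close>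
    have "list_wedge (\<lambda>l. (?\<omega>M l - ?\<omega>N l) + (?\<omega>N l - ?\<omega>P l)) (list_wedge ?a ?b) l = 0"
      by (rule list_wedge_derivation[OF ker_\<xi> ker_\<eta>]) (simp only: odd_N odd_P diff_self simp_thms)
    then show ?thesis by (simp only: diff_add_cancel add_diff_eq)
  qed
  have alt: "alternating_on (tangent_space A x) (sympl M x)" "alternating_on (tangent_space C z) (sympl P z)"
    using prequantum_systemD(3)[OF M] prequantum_systemD(3)[OF P] by (simp_all add: real_forms_def)
  have vertical: "?w (u # l) = 0" if "u \<in> set ?us" for u l
  proof -
    \<comment> \<open>The zero components give zero tangent vectors on M and P, on which alternating
      forms vanish.\<close>
    have u: "fst u = 0" "snd (snd u) = 0" using that by auto
    have "sympl M x (coord_vec A c x 0 # map (coord_vec A c x) (map fst l)) = 0"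
      unfolding coord_vec_zero[OF A c] using coord_vec_in_tangent_space[OF A c, of 0] set_map_coord_vec[OF A c, of "map fst l"]
      by (intro alternating_on_zero_Cons[OF alt(1)]) (simp_all add: coord_vec_zero[OF A c] image_image)
    moreover have "sympl P z (coord_vec C g z 0 # map (coord_vec C g z) (map (\<lambda>h. snd (snd h)) l)) = 0"
      unfolding coord_vec_zero[OF C g] using coord_vec_in_tangent_space[OF C g, of 0] set_map_coord_vec[OF C g, of "map (\<lambda>h. snd (snd h)) l"]
      by (intro alternating_on_zero_Cons[OF alt(2)]) (simp_all add: coord_vec_zero[OF C g] image_image)
    ultimately show ?thesis using u by simp
  qed
  \<comment> \<open>The two-form on the base is rewritten on horizontal lifts, and the constant
    \<open>?\<kappa>\<close> is taken out.\<close>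
  have "(\<Sum>S\<in>Pow {..<length hs}. (shuffle_sign (length hs) S * sympl MP (x, z) (map v (nths hs S))) *\<^sub>R
      fibre_form \<xi> \<eta> x z (map v (nths hs (- S))) y (map (coord_vec B d y) bs)) =
    (\<Sum>S\<in>Pow {..<length hs}. shuffle_sign (length hs) S *\<^sub>R (?w (map ?h (nths hs S)) *
      list_wedge ?a ?b (?us @ map ?h (nths hs (- S))))) * ?\<kappa>"
    unfolding v_def sympl_MP_coord_vec[OF c d g]
      fibre_form_coord_vec[where \<xi> = \<xi> and \<eta> = \<eta>, OF c d g e s f \<xi>_fib \<eta>_fib]
    by (simp add: sum_distrib_right scaleR_conv_of_real comp_def mult.assoc)
  also have "\<dots> = list_wedge ?w (\<lambda>l. list_wedge ?a ?b (?us @ l)) (map ?h hs) * ?\<kappa>"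
    by (simp only: list_wedge_def[of ?w] nths_map length_map)
  also have "list_wedge ?w (\<lambda>l. list_wedge ?a ?b (?us @ l)) (map ?h hs) =
      list_wedge ?w (list_wedge ?a ?b) (?us @ map ?h hs)"
    by (rule list_wedge_append[symmetric]) (use vertical odd_M odd_P in auto)
  also have "\<dots> = 0" by (rule relation)
  finally show ?thesis by simp
qed

lemma lefschetz_compose_forms:
  assumes \<xi>: "\<xi> \<in> Gamma_forms MN" and \<eta>: "\<eta> \<in> Gamma_forms NP"
  shows "lefschetz MP (compose_forms M N P \<xi> \<eta>) = 0"
proof -
  have main: "lefschetz MP (compose_forms M N P \<xi> \<eta>) (x, z) ws = 0" for x z ws
  proof (cases "set ws \<subseteq> tangent_space (prod_atlas A C) (x, z)")
    case True
    obtain c g where c: "c \<in> A" "x \<in> fst c" and g: "g \<in> C" "z \<in> fst g"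
      using some_chart[OF A] some_chart[OF C] by blast
    let ?c = "prod_chart c g"
    define v where "v = coord_vec (prod_atlas A C) ?c (x, z)"
    define hs where "hs = map (\<lambda>w. w ?c) ws"
    have ws: "ws = map v hs"
      unfolding v_def hs_def
      by (rule map_coord_vec_component[symmetric]) (use True c g in \<open>auto simp: prod_chart_in_prod_atlas\<close>)
    have T: "set (map v l) \<subseteq> tangent_space (prod_atlas A C) (x, z)" for l
      unfolding v_def by (rule set_map_coord_vec) (use c g in \<open>auto simp: prod_chart_in_prod_atlas smooth_atlas_prod A C\<close>)
    let ?r = "\<lambda>S. shuffle_sign (length hs) S * sympl MP (x, z) (map v (nths hs S))"
    let ?I = "\<lambda>S. symplectic_integral B (sympl N) (fibre_form \<xi> \<eta> x z (map v (nths hs (- S))))"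
    have bf: "\<xi> \<in> bundle_forms (prod_atlas A B) (lbundle MN)" "\<eta> \<in> bundle_forms (prod_atlas B C) (lbundle NP)"
      using \<xi> \<eta> by (simp_all add: Gamma_forms_def atlas_MN atlas_NP)
    \<comment> \<open>One term for each way of splitting the fixed arguments between the two-form
      and the composition.\<close>
    have "(\<Sum>S\<in>Pow {..<length hs}. ?r S *\<^sub>R ?I S) = 0"
    proof (rule symplectic_integral_linear_relation[OF B prequantum_systemD(2,3)[OF N]])
      show "continuous_on (fst d) (\<lambda>y. fibre_form \<xi> \<eta> x z (map v (nths hs (- S))) y (map (coord_vec B d y) model_basis))"
        if "d \<in> B" for d S
        unfolding v_def using bf c that g by (rule fibre_form_continuous_on)
      show "(\<Sum>S\<in>Pow {..<length hs}. ?r S *\<^sub>R fibre_form \<xi> \<eta> x z (map v (nths hs (- S))) y (map (coord_vec B d y) model_basis)) = 0"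
        if "d \<in> B" "y \<in> fst d" for d y
        unfolding v_def using \<xi> \<eta> c that g by (rule pointwise_relation)
    qed
    moreover have "lefschetz MP (compose_forms M N P \<xi> \<eta>) (x, z) ws =
        (\<Sum>S\<in>Pow {..<length hs}. ?r S *\<^sub>R ?I S) *\<^sub>C line_basis (fib (lbundle MP) (x, z))"
      unfolding ws lefschetz_def wedge_def nths_map compose_forms_eq length_map
      using T by (simp add: scaleR_scaleC scaleC_scaleC sum_scaleC_left scaleC_complex_def mult.assoc)
    ultimately show ?thesis by simp
  next
    case False
    \<comment> \<open>If some argument is not tangent, every splitting hands it to one of the two
      factors, and each is 0 on such lists by its default value.\<close>
    have "sympl MP (x, z) (nths ws S) *\<^sub>R compose_forms M N P \<xi> \<eta> (x, z) (nths ws (- S)) = 0" for S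
    proof (cases "set (nths ws S) \<subseteq> tangent_space (prod_atlas A C) (x, z)")
      case True
      then have "\<not> set (nths ws (- S)) \<subseteq> tangent_space (prod_atlas A C) (x, z)"
        using False by (force simp: set_nths in_set_conv_nth)
      then show ?thesis by (simp add: compose_forms_eq)
    next
      case False
      then have "sympl MP (x, z) (nths ws S) = 0"
        by (simp add: prod_system_def Let_def pullback_def dual_system_def)
      then show ?thesis by simp
    qed
    then show ?thesis
      by (simp only: lefschetz_def wedge_def scaleR_zero_right sum.neutral_const)
  qed
  show ?thesis
  proof (rule ext, rule ext)
    show "lefschetz MP (compose_forms M N P \<xi> \<eta>) u ws = 0 u ws" for u ws
      using main[of "fst u" "snd u" ws] by (simp only: prod.collapse zero_fun_apply)
  qed
qed

text \<open>The function \<open>tensor\<close> is bilinear only on its two lines, so vanishing is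
  checked on coefficients: those of the zero form are 0 in any frame, which makes the integrand 0 on
  every coordinate frame.\<close>

lemma compose_forms_eq_0:
  assumes \<xi>: "\<And>u vs. \<xi> u vs \<in> fib (lbundle MN) u" and \<eta>: "\<And>u vs. \<eta> u vs \<in> fib (lbundle NP) u"
    and zero: "\<xi> = 0 \<or> \<eta> = 0"
  shows "compose_forms M N P \<xi> \<eta> = 0"
proof -
  have main: "compose_forms M N P \<xi> \<eta> (x, z) ws = 0" for x z ws
  proof (cases "set ws \<subseteq> tangent_space (prod_atlas A C) (x, z)")
    case True
    obtain c g where c: "c \<in> A" "x \<in> fst c" and g: "g \<in> C" "z \<in> fst g"
      using some_chart[OF A] some_chart[OF C] by blast
    have ws: "ws = map (coord_vec (prod_atlas A C) (prod_chart c g) (x, z)) (map (\<lambda>w. w (prod_chart c g)) ws)"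
      by (rule map_coord_vec_component[symmetric]) (use True c g in \<open>auto simp: prod_chart_in_prod_atlas\<close>)
    have "symplectic_integral B (sympl N) (fibre_form \<xi> \<eta> x z ws) = 0"
    proof (rule symplectic_integral_eq_0[OF B prequantum_systemD(2,3)[OF N]])
      fix d y assume d: "d \<in> B" "y \<in> fst d"
      obtain e s f where e: "e \<in> fib (lbundle M) x" "e \<noteq> 0" and s: "s \<in> fib (lbundle N) y" "s \<noteq> 0"
        and f: "f \<in> dual_space (fib (lbundle P) z)" "f \<noteq> 0"
        using complex_line_nonzero lines by metis
      have "frame_MN x y e s \<noteq> 0" "frame_NP y z s f \<noteq> 0"
        using e s f dual_vector_in_dual_space[OF lines(2) s] dual_vector_nonzero[OF s]
        by (simp_all add: tensor_nonzero lines)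
      then have "(\<forall>l. local_coeff (prod_atlas A B) (prod_chart c d) (frame_MN x y e s) \<xi> (x, y) l = 0) \<or>
          (\<forall>l. local_coeff (prod_atlas B C) (prod_chart d g) (frame_NP y z s f) \<eta> (y, z) l = 0)"
        using zero by (auto simp: local_coeff_def line_coeff_zero)
      then show "fibre_form \<xi> \<eta> x z ws y (map (coord_vec B d y) model_basis) = 0"
        by (subst ws, subst fibre_form_coord_vec[where \<xi> = \<xi> and \<eta> = \<eta>, OF c d g e s f \<xi> \<eta>])
          (auto simp: list_wedge_zero_left list_wedge_zero_right)
    qed
    then show ?thesis by (simp add: compose_forms_eq)
  qed (simp add: compose_forms_eq)
  show ?thesis
  proof (rule ext, rule ext)
    show "compose_forms M N P \<xi> \<eta> u ws = 0 u ws" for u ws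
      using main[of "fst u" "snd u" ws] by (simp only: prod.collapse zero_fun_apply)
  qed
qed

end

theorem corollary4p5:
  fixes M :: "('m::{t2_space, second_countable_topology}, 'a::finite_dim_normed, 'l::complex_vector) prequantum"
    and N :: "('n::{t2_space, second_countable_topology}, 'b::finite_dim_normed, 'k::complex_vector) prequantum"
    and P :: "('p::{t2_space, second_countable_topology}, 'c::finite_dim_normed, 'j::complex_vector) prequantum"
  assumes "prequantum_system M" and "prequantum_system N" and "prequantum_system P"
    and "\<sigma> \<in> Gamma_forms (prod_system M (dual_system N))"
    and "\<zeta> \<in> Gamma_forms (prod_system N (dual_system P))"
  shows "lefschetz (prod_system M (dual_system P)) (compose_forms M N P \<sigma> \<zeta>) =
    compose_forms M N P (lefschetz (prod_system M (dual_system N)) \<sigma>) \<zeta> +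
    compose_forms M N P \<sigma> (lefschetz (prod_system N (dual_system P)) \<zeta>)"
proof -
  interpret three_prequantum M N P using assms(1-3) by unfold_locales
  have \<sigma>: "\<sigma> u vs \<in> fib (lbundle MN) u" "lefschetz MN \<sigma> = 0"
    and \<zeta>: "\<zeta> v ws \<in> fib (lbundle NP) v" "lefschetz NP \<zeta> = 0" for u vs v ws
    by (rule Gamma_formsD[OF assms(4)] Gamma_formsD[OF assms(5)])+
  \<comment> \<open>Once \<open>lefschetz\<close> has produced the zero form, its values must still
    be known to lie in the fibres, which holds because lines contain 0.\<close>
  have zero: "0 u vs \<in> fib (lbundle MN) u" "0 v ws \<in> fib (lbundle NP) v" for u vs v ws
    using complex_line_zero[OF complex_line_fib(1)] complex_line_zero[OF complex_line_fib(2)]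
    by (cases u; cases v; simp)+
  have "compose_forms M N P 0 \<zeta> = 0" "compose_forms M N P \<sigma> 0 = 0"
    using compose_forms_eq_0 zero \<sigma>(1) \<zeta>(1) by blast+
  then show ?thesis
    using lefschetz_compose_forms[OF assms(4,5)] by (simp only: \<sigma>(2) \<zeta>(2) add_0_left)
qed

end
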